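(* Let $p$ be an odd prime. For any discrete $A$-module $M$ there is an exact sequence of discrete $A$-modules $$0\to M\xrightarrow{\alpha} UM\xrightarrow{\beta} UM\xrightarrow{\gamma} M\otimes\mathbb{Q}\to0,$$ where $UM=\mathrm{Hom}^{\mathrm{cts}}_{\mathbb{Z}_{(p)}}(A,M)$ is formed from the underlying $\mathbb{Z}_{(p)}$-module of $M$.
   Context: $A$ is the ring of degree zero stable operations in $p$-local complex $K$-theory. Fix $q$ primitive mod $p^2$, $\Psi^q\in A$ the Adams operation, $q_i=q^{(-1)^i\lfloor i/2\rfloor}$, $\Theta_n(X)=\prod_{i=1}^n(X-q_i)$, $\Phi_n=\Theta_n(\Psi^q)$; every element of $A$ is uniquely a convergent sum $\sum_{n\ge0}a_n\Phi_n$ with $a_n\in\mathbb{Z}_{(p)}$, and $A_m=\{\sum_{n\ge m}a_n\Phi_n\}$. An $A$-module $M$ is discrete if each $x\in M$ satisfies $A_nx=0$ for some $n$. For a $\mathbb{Z}_{(p)}$-module $L$, $\mathrm{Hom}^{\mathrm{cts}}_{\mathbb{Z}_{(p)}}(A,L)$ is the set of $\mathbb{Z}_{(p)}$-homomorphisms $f:A\to L$ whose kernel contains some $A_n$ (i.e. continuous for the $A_m$-filtration topology on $A$ and the discrete topology on $L$), an $A$-module via $(af)(t)=f(ta)$; it is a discrete $A$-module. $M\otimes\mathbb{Q}$ carries the $A$-module structure induced from $M$. *)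

theory Defs
  imports "HOL-Algebra.Module" "HOL-Computational_Algebra.Polynomial" "HOL-Number_Theory.Cong"
begin

section \<open>The ring A of degree zero stable operations in p-local K-theory\<close>

definition Zploc :: "nat \<Rightarrow> rat set" where
  "Zploc p = {r. \<exists>a b :: int. \<not> int p dvd b \<and> r = of_int a / of_int b}"

definition prim_root_mod :: "int \<Rightarrow> int \<Rightarrow> bool" where
  "prim_root_mod m q \<longleftrightarrow> coprime q m \<and> (\<forall>x. coprime x m \<longrightarrow> (\<exists>k::nat. [q ^ k = x] (mod m)))"

definition qseq :: "int \<Rightarrow> nat \<Rightarrow> rat" where
  "qseq q i = (if even i then of_int q ^ (i div 2) else inverse (of_int q ^ (i div 2)))"

definition Theta :: "int \<Rightarrow> nat \<Rightarrow> rat poly" where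
  "Theta q n = (\<Prod>i\<in>{1..n}. [:- qseq q i, 1:])"

definition newton_coord :: "int \<Rightarrow> rat poly \<Rightarrow> nat \<Rightarrow> rat" where
  "newton_coord q P = (THE c. (\<forall>k > Polynomial.degree P. c k = 0) \<and>
       P = (\<Sum>k\<le>Polynomial.degree P. Polynomial.smult (c k) (Theta q k)))"

text \<open>An element sum_n a_n Phi_n of A is represented by its coefficient sequence a.\<close>
definition A_set :: "nat \<Rightarrow> (nat \<Rightarrow> rat) set" where
  "A_set p = {a. \<forall>n. a n \<in> Zploc p}"

definition A_filt :: "nat \<Rightarrow> nat \<Rightarrow> (nat \<Rightarrow> rat) set" where
  "A_filt p m = {a \<in> A_set p. \<forall>n<m. a n = 0}"

text \<open>Product: continuous extension of the polynomial product
  Phi_m Phi_n = sum_k c_{m,n,k} Phi_k, where c_{m,n,k} = 0 unless k >= max m n.\<close>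
definition A_mult :: "int \<Rightarrow> (nat \<Rightarrow> rat) \<Rightarrow> (nat \<Rightarrow> rat) \<Rightarrow> (nat \<Rightarrow> rat)" where
  "A_mult q a b = (\<lambda>k. \<Sum>m\<le>k. \<Sum>n\<le>k. a m * b n * newton_coord q (Theta q m * Theta q n) k)"

definition A_one :: "nat \<Rightarrow> rat" where
  "A_one = (\<lambda>n. if n = 0 then 1 else 0)"

definition A_ring :: "nat \<Rightarrow> int \<Rightarrow> (nat \<Rightarrow> rat) ring" where
  "A_ring p q = \<lparr>carrier = A_set p, monoid.mult = A_mult q, one = A_one,
                  zero = (\<lambda>_. 0), add = (\<lambda>a b n. a n + b n)\<rparr>"

definition scal :: "rat \<Rightarrow> nat \<Rightarrow> rat" where
  "scal r = (\<lambda>n. if n = 0 then r else 0)"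

definition A_discrete :: "nat \<Rightarrow> ((nat \<Rightarrow> rat), 'm) module \<Rightarrow> bool" where
  "A_discrete p M \<longleftrightarrow>
     (\<forall>x\<in>carrier M. \<exists>n. \<forall>a\<in>A_filt p n. a \<odot>\<^bsub>M\<^esub> x = \<zero>\<^bsub>M\<^esub>)"

definition Amod_hom :: "('a, 'r) ring_scheme \<Rightarrow> ('a, 'm) module \<Rightarrow> ('a, 'n) module
    \<Rightarrow> ('m \<Rightarrow> 'n) \<Rightarrow> bool" where
  "Amod_hom R M N f \<longleftrightarrow> f \<in> carrier M \<rightarrow> carrier N \<and>
     (\<forall>x\<in>carrier M. \<forall>y\<in>carrier M. f (x \<oplus>\<^bsub>M\<^esub> y) = f x \<oplus>\<^bsub>N\<^esub> f y) \<and>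
     (\<forall>a\<in>carrier R. \<forall>x\<in>carrier M. f (a \<odot>\<^bsub>M\<^esub> x) = a \<odot>\<^bsub>N\<^esub> f x)"

definition UM_carrier :: "nat \<Rightarrow> ((nat \<Rightarrow> rat), 'm) module \<Rightarrow> ((nat \<Rightarrow> rat) \<Rightarrow> 'm) set" where
  "UM_carrier p M = {f. f \<in> extensional (A_set p) \<and> f \<in> A_set p \<rightarrow> carrier M \<and>
     (\<forall>s\<in>A_set p. \<forall>t\<in>A_set p. f (\<lambda>n. s n + t n) = f s \<oplus>\<^bsub>M\<^esub> f t) \<and>
     (\<forall>r\<in>Zploc p. \<forall>t\<in>A_set p. f (\<lambda>n. r * t n) = scal r \<odot>\<^bsub>M\<^esub> f t) \<and>
     (\<exists>n. \<forall>t\<in>A_filt p n. f t = \<zero>\<^bsub>M\<^esub>)}"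

definition UM :: "nat \<Rightarrow> int \<Rightarrow> ((nat \<Rightarrow> rat), 'm) module
    \<Rightarrow> ((nat \<Rightarrow> rat), (nat \<Rightarrow> rat) \<Rightarrow> 'm) module" where
  "UM p q M = \<lparr>carrier = UM_carrier p M, monoid.mult = (\<lambda>_ _. undefined), one = undefined,
     zero = (\<lambda>t\<in>A_set p. \<zero>\<^bsub>M\<^esub>),
     add = (\<lambda>f g. \<lambda>t\<in>A_set p. f t \<oplus>\<^bsub>M\<^esub> g t),
     module.smult = (\<lambda>a f. \<lambda>t\<in>A_set p. f (A_mult q t a))\<rparr>"

section \<open>M \<otimes> Q (as the localisation of M at the positive integers)\<close>

definition MQ_rel :: "('a, 'm) module \<Rightarrow> (('m \<times> nat) \<times> ('m \<times> nat)) set" where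
  "MQ_rel M = {((x, s), (y, t)). x \<in> carrier M \<and> y \<in> carrier M \<and> s > 0 \<and> t > 0 \<and>
      (\<exists>u::nat. u > 0 \<and> add_pow M (u * t) x = add_pow M (u * s) y)}"

definition MQ_class :: "('a, 'm) module \<Rightarrow> 'm \<Rightarrow> nat \<Rightarrow> ('m \<times> nat) set" where
  "MQ_class M x s = MQ_rel M `` {(x, s)}"

definition MQ :: "('a, 'm) module \<Rightarrow> ('a, ('m \<times> nat) set) module" where
  "MQ M = \<lparr>carrier = (carrier M \<times> {s. s > 0}) // MQ_rel M,
     monoid.mult = (\<lambda>_ _. undefined), one = undefined,
     zero = MQ_class M \<zero>\<^bsub>M\<^esub> 1,
     add = (\<lambda>X Y. \<Union>(x, s)\<in>X. \<Union>(y, t)\<in>Y. MQ_class M (add_pow M (t) x \<oplus>\<^bsub>M\<^esub> add_pow M (s) y) (s * t)),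
     module.smult = (\<lambda>a X. \<Union>(x, s)\<in>X. MQ_class M (a \<odot>\<^bsub>M\<^esub> x) s)\<rparr>"

end

theory Submission
  imports Defs "HOL-Number_Theory.Residues"
begin

text \<open>
  Evaluating at the pairwise distinct nodes $q_1, q_2, \ldots$ embeds $A$ into the product of copies
  of the rationals, and $A_m$ consists of the elements vanishing at the first $m$ nodes. Put
  $\alpha(x)(t) = tx$ and $\beta(f)(t) = \Psi^q f(t) - f(\Psi^q t)$. In terms of the values
  $f_n = f(\Phi_n)$, almost all of which vanish, $\beta(f)_n = (\Psi^q - q_{n+1}) f_n - f_{n+1}$.
  On $M \otimes \mathbb{Q}$ any function on the nodes acts, by interpolating it on the first $m$
  nodes for elements killed by $A_m$; then $\gamma(f) = \sum_n C_{n+1} f_n$ with $C_n$ the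
  coefficients of the divided difference on the first $n$ nodes, and $\gamma\beta = 0$ by
  telescoping. Conversely, solving $\beta(f) = g$ recursively from $f_0 = 0$ gives a sequence that
  becomes torsion when $\gamma(g) = 0$. It then vanishes eventually, since every node recurs modulo
  $p^k$ and so a long product of factors $\Psi^q - q_j$ lies in $A_m + p^k A$. The same recurrence
  yields surjectivity of $\gamma$.
\<close>

section \<open>The local ring\<close>

text \<open>The functions C_n are forced by the wish that \<gamma>\<beta> = 0: the sum of the terms
  C_(n+1) ((x - q_(n+1)) f_n - f_(n+1)) telescopes as soon as (x - q_(n+1)) C_(n+1) = C_n, and C_0 =
  0 disposes of the initial term. In general their values have powers of p in the denominators,
  because nodes agree modulo powers of p, so the C_n act only after rationalisation. Hence the sum
  is formed in M from integral multiples of the C_n, at a level m such that f kills A_m and A_m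
  kills all values of f, and is then divided by the multiplier; independence of the level has to be
  checked.

  A second obstacle is linearity. The module structure of UM moves the argument, (af)(t) = f(ta),
  whereas \<gamma> applies operators to the values of f and so is visibly linear only for the action
  a(f(t)). That both actions agree under \<gamma> is itself a consequence of \<gamma>\<beta> = 0,
  since \<beta> is their difference for a = \<Psi>^q.\<close>

lemma Zploc_iff: "r \<in> Zploc p \<longleftrightarrow> (\<exists>a b :: int. \<not> int p dvd b \<and> r = of_int a / of_int b)"
  by (simp add: Zploc_def)

lemma Zploc_of_int [simp]: "prime p \<Longrightarrow> of_int a \<in> Zploc p"
  unfolding Zploc_iff by (rule exI[of _ a], rule exI[of _ 1]) (auto dest: prime_gt_1_nat)

lemma Zploc_of_nat [simp]: "prime p \<Longrightarrow> of_nat a \<in> Zploc p"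
  using Zploc_of_int[of p "int a"] by simp

lemma Zploc_0 [simp]: "prime p \<Longrightarrow> 0 \<in> Zploc p"
  and Zploc_1 [simp]: "prime p \<Longrightarrow> 1 \<in> Zploc p"
  using Zploc_of_int[of p 0] Zploc_of_int[of p 1] by auto

lemma Zploc_add [simp]:
  assumes "prime p" "r \<in> Zploc p" "s \<in> Zploc p" shows "r + s \<in> Zploc p"
proof -
  obtain a b c d :: int where *: "\<not> int p dvd b" "r = of_int a / of_int b"
    "\<not> int p dvd d" "s = of_int c / of_int d" using assms by (auto simp: Zploc_iff)
  have "b \<noteq> 0" "d \<noteq> 0" using * by auto
  hence "r + s = of_int (a * d + c * b) / of_int (b * d)" using * by (simp add: field_simps)
  moreover have "\<not> int p dvd b * d" using * assms(1) by (simp add: prime_dvd_mult_iff)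
  ultimately show ?thesis unfolding Zploc_iff by blast
qed

lemma Zploc_mult [simp]:
  assumes "prime p" "r \<in> Zploc p" "s \<in> Zploc p" shows "r * s \<in> Zploc p"
proof -
  obtain a b c d :: int where *: "\<not> int p dvd b" "r = of_int a / of_int b"
    "\<not> int p dvd d" "s = of_int c / of_int d" using assms by (auto simp: Zploc_iff)
  hence "r * s = of_int (a * c) / of_int (b * d)" by simp
  moreover have "\<not> int p dvd b * d" using * assms(1) by (simp add: prime_dvd_mult_iff)
  ultimately show ?thesis unfolding Zploc_iff by blast
qed

lemma Zploc_uminus [simp]: "prime p \<Longrightarrow> r \<in> Zploc p \<Longrightarrow> - r \<in> Zploc p"
  using Zploc_mult[of p "of_int (-1)" r] Zploc_of_int[of p "-1"] by simp

lemma Zploc_diff [simp]: "prime p \<Longrightarrow> r \<in> Zploc p \<Longrightarrow> s \<in> Zploc p \<Longrightarrow> r - s \<in> Zploc p"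
  using Zploc_add[of p r "-s"] by simp

lemma Zploc_power [simp]: "prime p \<Longrightarrow> r \<in> Zploc p \<Longrightarrow> r ^ k \<in> Zploc p"
  by (induction k) auto

lemma Zploc_inverse_of_int: "prime p \<Longrightarrow> \<not> int p dvd b \<Longrightarrow> inverse (of_int b) \<in> Zploc p"
  unfolding Zploc_iff by (rule exI[of _ 1], rule exI[of _ b]) (auto simp: divide_inverse)

text \<open>Integers prime to p are units of the local ring, so this reduces torsion and
  denominators to powers of p, the only ones that the recurrence of the nodes can handle.\<close>

lemma prime_power_split:
  fixes d :: nat assumes "prime p" "d > 0"
  obtains k u where "d = p ^ k * u" "inverse (of_nat u) \<in> Zploc p" "u > 0"
proof -
  obtain u where u: "d = p ^ multiplicity p d * u" "\<not> p dvd u"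
    using assms multiplicity_decompose'[of d p] by (metis not_prime_unit gr0_implies_Suc nat.distinct(1))
  have "inverse (of_int (int u)) \<in> Zploc p"
    using assms u by (intro Zploc_inverse_of_int) auto
  with u assms that show ?thesis by (metis of_int_of_nat_eq gr0I mult_0_right less_irrefl)
qed

section \<open>Evaluation at the nodes\<close>

definition node :: "int \<Rightarrow> nat \<Rightarrow> rat" where "node q j = qseq q (Suc j)"

text \<open>The exponents run through 0, 1, -1, 2, -2, ...; as one signed power, the nodes are
  separated by strict monotonicity of e \<mapsto> \<bar>q\<bar>^e. Absolute values are taken because
  q may be negative.\<close>

lemma node_powi:
  "node q j = (of_int q) powi (if even j then - int (j div 2) else int (Suc j div 2))"
  by (auto simp: node_def qseq_def power_int_minus power_int_def nat_add_distrib power_inverse)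

lemma inj_node: assumes "\<bar>q\<bar> > 1" shows "inj (node q)"
proof (rule injI)
  fix i j assume "node q i = node q j"
  hence "\<bar>node q i\<bar> = \<bar>node q j\<bar>" by simp
  moreover have "1 < \<bar>of_int q :: rat\<bar>" using assms by linarith
  moreover have inj: "inj (\<lambda>e. \<bar>of_int q :: rat\<bar> powi e)"
    using \<open>1 < \<bar>of_int q :: rat\<bar>\<close>
    by (intro linorder_injI) (metis power_int_strict_increasing less_irrefl)
  ultimately have "(if even i then - int (i div 2) else int (Suc i div 2)) =
      (if even j then - int (j div 2) else int (Suc j div 2))"
    unfolding node_powi power_int_abs using injD[OF inj] by blast
  moreover obtain a where "i = 2 * a \<or> i = 2 * a + 1" by (metis oddE evenE)
  moreover obtain b where "j = 2 * b \<or> j = 2 * b + 1" by (metis oddE evenE)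
  ultimately show "i = j" by auto
qed

lemma node_Zploc: assumes "prime p" "\<not> int p dvd q" shows "node q j \<in> Zploc p"
proof -
  have "inverse (of_int q) \<in> Zploc p" using assms by (rule Zploc_inverse_of_int)
  thus ?thesis using assms unfolding node_def qseq_def
    by (auto simp flip: power_inverse intro!: Zploc_power)
qed

text \<open>Raising the index by 2T keeps its parity and changes the exponent by T in absolute
  value. For T a multiple of the totient of p^k this multiplies the node by a unit congruent to 1
  modulo p^k, and T can be taken as large as desired.\<close>

lemma node_recurs:
  assumes "prime p" "\<not> int p dvd q"
  shows "\<exists>j\<ge>n. \<exists>u\<in>Zploc p. node q j = node q l + of_nat p ^ k * u"
proof -
  define T where "T = totient (p ^ k) * n"
  have cop: "coprime q (int (p ^ k))"
    using assms prime_imp_coprime[of "int p" q] by (simp add: coprime_commute)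
  have "[q ^ totient (p ^ k) = 1] (mod int (p ^ k))"
  proof -
    have "int (p ^ k) > 0" using assms(1) prime_gt_0_nat by simp
    \<comment> \<open>Euler's theorem is applied to the least nonnegative residue of q, since q
      itself may be negative.\<close>
    hence n: "int (nat (q mod int (p ^ k))) = q mod int (p ^ k)" by simp
    have "coprime (nat (q mod int (p ^ k))) (p ^ k)"
      using cop n by (metis coprime_int_iff coprime_mod_left_iff \<open>int (p ^ k) > 0\<close> less_irrefl)
    hence "[nat (q mod int (p ^ k)) ^ totient (p ^ k) = 1] (mod p ^ k)" by (rule euler_theorem)
    hence "[(q mod int (p ^ k)) ^ totient (p ^ k) = 1] (mod int (p ^ k))"
      using n by (metis cong_int_iff of_nat_1 of_nat_power)
    thus ?thesis by (simp add: cong_def power_mod)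
  qed
  hence "[q ^ T = 1] (mod int (p ^ k))" unfolding T_def power_mult
    by (metis cong_pow power_one)
  then obtain c where c: "q ^ T = 1 + int (p ^ k) * c"
    by (metis cong_iff_lin cong_sym mult.commute)
  have c': "(of_int q :: rat) ^ T = 1 + of_nat p ^ k * of_int c"
    using arg_cong[OF c, of "of_int :: int \<Rightarrow> rat"] by simp
  have "totient (p^k) \<ge> 1" using assms(1) by (simp add: Suc_leI prime_gt_0_nat)
  hence "T \<ge> n" unfolding T_def by simp
  have q0: "q \<noteq> 0" using assms by auto
  \<comment> \<open>For even l the exponents are nonpositive, so q^T = 1 + p^k c relates the nodes
    in the opposite direction: node l is node l + 2T times q^T.\<close>
  define u :: rat where "u = (if even l then - of_int c * node q (l + 2 * T) else of_int c * node q l)"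
  have "u \<in> Zploc p" using assms node_Zploc[OF assms] by (auto simp: u_def)
  moreover have "node q (l + 2 * T) = node q l + of_nat p ^ k * u"
  proof (cases "even l")
    case True
    have "(l + 2 * T) div 2 = l div 2 + T" by simp
    hence "node q l = node q (l + 2 * T) * of_int q ^ T"
      using True q0 by (simp add: node_def qseq_def power_add)
    thus ?thesis using True unfolding c' u_def by (simp add: algebra_simps)
  next
    case False
    have "Suc (l + 2 * T) div 2 = Suc l div 2 + T" by simp
    hence "node q (l + 2 * T) = node q l * of_int q ^ T"
      using False q0 by (simp add: node_def qseq_def power_add)
    thus ?thesis using False unfolding c' u_def by (simp add: algebra_simps)
  qed
  ultimately show ?thesis using \<open>T \<ge> n\<close> by (intro exI[of _ "l + 2 * T"]) auto
qed

text \<open>The powers of 1 and -1 are again 1 or -1, but 2 must be congruent to a power of q; as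
  p^2 is at least 9, it divides neither 1 nor 3. Being prime to p puts the nodes into the local ring
  and makes them recur; \<bar>q\<bar> > 1 makes them distinct.\<close>

lemma prim_root_nontrivial:
  assumes "prime p" "odd p" "prim_root_mod (int p ^ 2) q"
  shows "\<not> int p dvd q" and "\<bar>q\<bar> > 1"
proof -
  have p3: "p \<ge> 3" using assms prime_ge_2_nat[of p] by (cases "p = 2") auto
  have "coprime q (int p)" using assms by (auto simp: prim_root_mod_def)
  thus np: "\<not> int p dvd q" using assms(1) p3
    by (metis coprime_common_divisor dvd_refl not_prime_unit prime_int_nat_transfer nat_int of_nat_0_le_iff)
  have "coprime (2::int) (int p ^ 2)" using assms(2) by simp
  then obtain k where k: "[q ^ k = 2] (mod int p ^ 2)" using assms(3) unfolding prim_root_mod_def by blast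
  have "int p ^ 2 \<ge> 9" using p3 power_mono[of 3 "int p" 2] by simp
  show "\<bar>q\<bar> > 1"
  proof (rule ccontr)
    assume "\<not> \<bar>q\<bar> > 1"
    hence "q = 1 \<or> q = -1" using np by (cases "q = 0") auto
    hence "q ^ k = 1 \<or> q ^ k = -1" by (cases "even k") auto
    hence "int p ^ 2 dvd 1 \<or> int p ^ 2 dvd 3" using k by (auto simp: cong_iff_dvd_diff)
    thus False using \<open>int p ^ 2 \<ge> 9\<close> by (auto dest: zdvd_imp_le)
  qed
qed

text \<open>This is the value of \<Theta>_n at the node with index i, counted from 0. It vanishes
  for i < n and is nonzero for i \<ge> n, so evaluation of coefficient sequences is
  triangular.\<close>

definition ntheta :: "int \<Rightarrow> nat \<Rightarrow> nat \<Rightarrow> rat" where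
  "ntheta q n i = (\<Prod>j<n. node q i - node q j)"

lemma ntheta_0 [simp]: "ntheta q 0 i = 1" by (simp add: ntheta_def)

lemma ntheta_Suc: "ntheta q (Suc n) i = ntheta q n i * (node q i - node q n)"
  by (simp add: ntheta_def)

lemma ntheta_eq_0 [simp]: "i < n \<Longrightarrow> ntheta q n i = 0"
  by (auto simp: ntheta_def)

lemma ntheta_neq_0: "\<bar>q\<bar> > 1 \<Longrightarrow> n \<le> i \<Longrightarrow> ntheta q n i \<noteq> 0"
  using inj_node[of q] by (auto simp: ntheta_def inj_eq)

lemma poly_Theta_node: "poly (Theta q n) (node q i) = ntheta q n i"
proof -
  have "{1..n} = Suc ` {..<n}" by (auto simp: image_iff less_Suc_eq_le gr0_conv_Suc Suc_le_eq)
  thus ?thesis by (simp add: Theta_def ntheta_def node_def poly_prod prod.reindex)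
qed

lemma Theta_monic: "Polynomial.degree (Theta q n) = n \<and> lead_coeff (Theta q n) = 1"
proof (induction n)
  case (Suc n)
  have *: "Theta q (Suc n) = Theta q n * [:- qseq q (Suc n), 1:]" by (simp add: Theta_def)
  have "Theta q n \<noteq> 0" using Suc by auto
  hence "Polynomial.degree (Theta q (Suc n)) = Suc n" unfolding *
    using Suc by (subst degree_mult_eq) auto
  moreover have "lead_coeff (Theta q (Suc n)) = 1" 
  proof -
    have "lead_coeff [:- qseq q (Suc n), 1:] = 1" by simp
    thus ?thesis unfolding * lead_coeff_mult using Suc by (metis mult_1)
  qed
  ultimately show ?case by simp
qed (simp add: Theta_def)

lemma Theta_expansion_exists:
  "Polynomial.degree P \<le> d \<Longrightarrow>
     \<exists>c. (\<forall>k>d. c k = 0) \<and> P = (\<Sum>k\<le>d. Polynomial.smult (c k) (Theta q k))"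
proof (induction d arbitrary: P)
  case 0
  then obtain a where "P = [:a:]" by (auto elim: degree_eq_zeroE)
  thus ?case by (intro exI[of _ "\<lambda>k. if k = 0 then a else 0"]) (auto simp: Theta_def)
next
  case (Suc d)
  define P' where "P' = P - Polynomial.smult (poly.coeff P (Suc d)) (Theta q (Suc d))"
  have "Polynomial.degree P' \<le> d"
  proof (rule degree_le, intro allI impI)
    fix i assume "d < i"
    thus "poly.coeff P' i = 0" using Suc.prems Theta_monic[of q "Suc d"]
      by (cases "i = Suc d") (auto simp: P'_def coeff_eq_0)
  qed
  then obtain c where c: "\<forall>k>d. c k = 0" "P' = (\<Sum>k\<le>d. Polynomial.smult (c k) (Theta q k))"
    using Suc.IH by blast
  show ?case
  proof (intro exI[of _ "c(Suc d := poly.coeff P (Suc d))"] conjI)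
    have "P = P' + Polynomial.smult (poly.coeff P (Suc d)) (Theta q (Suc d))" by (simp add: P'_def)
    also have "P' = (\<Sum>k\<le>d. Polynomial.smult ((c(Suc d := poly.coeff P (Suc d))) k) (Theta q k))"
      unfolding c(2) by (rule sum.cong) auto
    finally show "P = (\<Sum>k\<le>Suc d. Polynomial.smult ((c(Suc d := poly.coeff P (Suc d))) k) (Theta q k))"
      by simp
  qed (use c in auto)
qed

section \<open>Sequences as functions on the nodes\<close>

text \<open>At node i every \<Theta>_n with n > i vanishes, so the finite sum is the value of the
  whole infinite series.\<close>

definition eval_seq :: "int \<Rightarrow> (nat \<Rightarrow> rat) \<Rightarrow> nat \<Rightarrow> rat" where
  "eval_seq q a i = (\<Sum>n\<le>i. a n * ntheta q n i)"

lemma eval_seq_extend: "i \<le> N \<Longrightarrow> eval_seq q a i = (\<Sum>n\<le>N. a n * ntheta q n i)"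
  unfolding eval_seq_def by (rule sum.mono_neutral_left) auto

lemma eval_seq_cong: "(\<And>n. n \<le> i \<Longrightarrow> a n = b n) \<Longrightarrow> eval_seq q a i = eval_seq q b i"
  by (simp add: eval_seq_def)

text \<open>A triangular system with nonzero diagonal entries \<open>ntheta q n n\<close> is solved
  from the top. This turns the filtration of A into vanishing at initial nodes.\<close>

lemma eval_seq_zero_iff:
  assumes "\<bar>q\<bar> > 1"
  shows "(\<forall>i<m. eval_seq q a i = 0) \<longleftrightarrow> (\<forall>n<m. a n = 0)"
proof
  assume *: "\<forall>i<m. eval_seq q a i = 0"
  have "n < m \<Longrightarrow> a n = 0" for n
  proof (induction n rule: less_induct)
    case (less n)
    have "eval_seq q a n = a n * ntheta q n n" unfolding eval_seq_def
      by (rule sum.remove[THEN trans, of _ n]) (use less in auto)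
    thus ?case using * less.prems ntheta_neq_0[OF assms, of n n] by auto
  qed
  thus "\<forall>n<m. a n = 0" by blast
qed (simp add: eval_seq_def)

lemma eval_seq_add: "eval_seq q (\<lambda>n. a n + b n) = (\<lambda>i. eval_seq q a i + eval_seq q b i)"
  by (simp add: eval_seq_def fun_eq_iff sum.distrib algebra_simps)

lemma eval_seq_diff: "eval_seq q (\<lambda>n. a n - b n) = (\<lambda>i. eval_seq q a i - eval_seq q b i)"
  by (simp add: eval_seq_def fun_eq_iff sum_subtractf algebra_simps)

lemma eval_seq_cmult: "eval_seq q (\<lambda>n. r * a n) = (\<lambda>i. r * eval_seq q a i)"
  by (simp add: eval_seq_def fun_eq_iff sum_distrib_left algebra_simps)

lemma inj_eval_seq: assumes "\<bar>q\<bar> > 1" shows "inj (eval_seq q)"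
proof (rule injI)
  fix a b assume "eval_seq q a = eval_seq q b"
  hence "\<forall>i<Suc m. eval_seq q (\<lambda>n. a n - b n) i = 0" for m by (simp add: eval_seq_diff)
  hence "a m - b m = 0" for m using eval_seq_zero_iff[OF assms, of "Suc m" "\<lambda>n. a n - b n"] by auto
  thus "a = b" by (auto simp: fun_eq_iff)
qed

text \<open>Existence comes from the monic polynomials \<open>Theta q k\<close>; uniqueness holds
  because the coefficients are determined by the values of P at the nodes. Both are needed to unfold
  the definite description.\<close>

lemma newton_coord_expansion:
  assumes "\<bar>q\<bar> > 1"
  shows "(\<forall>k > Polynomial.degree P. newton_coord q P k = 0) \<and>
       P = (\<Sum>k\<le>Polynomial.degree P. Polynomial.smult (newton_coord q P k) (Theta q k))"
proof -
  define d where "d = Polynomial.degree P"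
  define Q where "Q c \<longleftrightarrow> (\<forall>k>d. c k = 0) \<and> P = (\<Sum>k\<le>d. Polynomial.smult (c k) (Theta q k))" for c
  have ev: "eval_seq q c i = poly P (node q i)" if "Q c" for c i
  proof -
    have "poly P (node q i) = (\<Sum>k\<le>d. c k * ntheta q k i)"
      using that by (simp add: Q_def poly_sum poly_Theta_node)
    also have "\<dots> = (\<Sum>k\<le>max d i. c k * ntheta q k i)"
      using that by (intro sum.mono_neutral_left) (auto simp: Q_def)
    also have "\<dots> = eval_seq q c i" by (rule eval_seq_extend[symmetric]) simp
    finally show ?thesis by simp
  qed
  have "\<exists>!c. Q c"
  proof (rule ex_ex1I)
    show "\<exists>c. Q c" unfolding Q_def d_def by (rule Theta_expansion_exists) simp
    show "c = c'" if "Q c" "Q c'" for c c'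
      using inj_eval_seq[OF assms] ev[OF that(1)] ev[OF that(2)] by (auto simp: inj_def fun_eq_iff)
  qed
  hence "Q (THE c. Q c)" by (rule theI')
  thus ?thesis unfolding newton_coord_def Q_def d_def .
qed

lemma eval_newton_coord:
  assumes "\<bar>q\<bar> > 1"
  shows "eval_seq q (newton_coord q P) i = poly P (node q i)"
proof -
  note nc = newton_coord_expansion[OF assms, of P]
  let ?d = "Polynomial.degree P" and ?c = "newton_coord q P"
  have "poly P (node q i) = poly (\<Sum>k\<le>?d. Polynomial.smult (?c k) (Theta q k)) (node q i)"
    using nc by simp
  also have "\<dots> = (\<Sum>k\<le>?d. ?c k * ntheta q k i)" by (simp add: poly_sum poly_Theta_node)
  also have "\<dots> = (\<Sum>k\<le>max ?d i. ?c k * ntheta q k i)"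
    using nc by (intro sum.mono_neutral_left) auto
  also have "\<dots> = eval_seq q ?c i" by (rule eval_seq_extend[symmetric]) simp
  finally show ?thesis by simp
qed

text \<open>The product vanishes at the first \<open>max m n\<close> nodes. This is what makes the
  finite sums in \<open>A_mult\<close> capture the full product of two infinite series.\<close>

lemma newton_coord_Theta_mult_0:
  assumes "\<bar>q\<bar> > 1" "k < max m n"
  shows "newton_coord q (Theta q m * Theta q n) k = 0"
proof -
  have "\<forall>i<max m n. eval_seq q (newton_coord q (Theta q m * Theta q n)) i = 0"
    by (auto simp: eval_newton_coord[OF assms(1)] poly_Theta_node less_max_iff_disj)
  thus ?thesis using assms eval_seq_zero_iff[OF assms(1)] by blast
qed

lemma eval_A_mult:
  assumes "\<bar>q\<bar> > 1"
  shows "eval_seq q (A_mult q a b) = (\<lambda>i. eval_seq q a i * eval_seq q b i)"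
proof
  fix i
  define c where "c m n = newton_coord q (Theta q m * Theta q n)" for m n
  \<comment> \<open>Both summation ranges are enlarged from k to i, the same for all k \<le> i, by
    terms that vanish; only then can the sum over k be moved inside.\<close>
  have "A_mult q a b k = (\<Sum>m\<le>i. \<Sum>n\<le>i. a m * b n * c m n k)" if "k \<le> i" for k
  proof -
    have "A_mult q a b k = (\<Sum>m\<le>k. \<Sum>n\<le>i. a m * b n * c m n k)" unfolding A_mult_def c_def
      using that by (intro sum.cong sum.mono_neutral_left) (auto simp: newton_coord_Theta_mult_0[OF assms] less_max_iff_disj)
    also have "\<dots> = (\<Sum>m\<le>i. \<Sum>n\<le>i. a m * b n * c m n k)"
      using that by (intro sum.mono_neutral_left) (auto intro!: sum.neutral simp: c_def newton_coord_Theta_mult_0[OF assms] less_max_iff_disj)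
    finally show ?thesis .
  qed
  hence "eval_seq q (A_mult q a b) i = (\<Sum>k\<le>i. (\<Sum>m\<le>i. \<Sum>n\<le>i. a m * b n * c m n k) * ntheta q k i)"
    by (simp add: eval_seq_def)
  also have "\<dots> = (\<Sum>m\<le>i. \<Sum>n\<le>i. \<Sum>k\<le>i. a m * b n * (c m n k * ntheta q k i))"
  proof -
    have "(\<Sum>k\<le>i. (\<Sum>m\<le>i. \<Sum>n\<le>i. a m * b n * c m n k) * ntheta q k i) =
        (\<Sum>k\<le>i. \<Sum>m\<le>i. \<Sum>n\<le>i. a m * b n * (c m n k * ntheta q k i))"
      by (simp add: sum_distrib_right mult.assoc)
    also have "\<dots> = (\<Sum>m\<le>i. \<Sum>k\<le>i. \<Sum>n\<le>i. a m * b n * (c m n k * ntheta q k i))"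
      by (rule sum.swap)
    also have "\<dots> = (\<Sum>m\<le>i. \<Sum>n\<le>i. \<Sum>k\<le>i. a m * b n * (c m n k * ntheta q k i))"
      by (intro sum.cong refl sum.swap)
    finally show ?thesis .
  qed
  also have "\<dots> = (\<Sum>m\<le>i. \<Sum>n\<le>i. a m * b n * (ntheta q m i * ntheta q n i))"
    using eval_newton_coord[OF assms, of "Theta q _ * Theta q _" i]
    unfolding sum_distrib_left[symmetric] c_def eval_seq_def poly_mult poly_Theta_node by simp
  also have "\<dots> = eval_seq q a i * eval_seq q b i"
    by (simp add: eval_seq_def sum_product algebra_simps)
  finally show "eval_seq q (A_mult q a b) i = eval_seq q a i * eval_seq q b i" .
qed

section \<open>Discrete modules\<close>

locale discrete_module = Module.module "A_ring p q" M
  for p :: nat and q :: int and M :: "((nat \<Rightarrow> rat), 'm) module" +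
  assumes prime_p: "prime p" and not_dvd: "\<not> int p dvd q" and abs_q: "\<bar>q\<bar> > 1"
    and discrete: "A_discrete p M"
begin

abbreviation E :: "(nat \<Rightarrow> rat) \<Rightarrow> nat \<Rightarrow> rat" where "E \<equiv> eval_seq q"

definition eval_ring :: "(nat \<Rightarrow> rat) set" where "eval_ring = E ` A_set p"

text \<open>Elements of $A$ act through their values at the nodes, so that products become pointwise.\<close>
definition act :: "(nat \<Rightarrow> rat) \<Rightarrow> 'm \<Rightarrow> 'm" where
  "act v x = inv_into UNIV E v \<odot>\<^bsub>M\<^esub> x"

lemmas Zploc_simps [simp] = Zploc_of_int[OF prime_p] Zploc_of_nat[OF prime_p] Zploc_0[OF prime_p]
  Zploc_1[OF prime_p] Zploc_add[OF prime_p] Zploc_mult[OF prime_p] Zploc_uminus[OF prime_p]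
  Zploc_diff[OF prime_p] Zploc_power[OF prime_p] node_Zploc[OF prime_p not_dvd]

section \<open>The action of A as a ring of functions on the nodes\<close>

lemma A_ring_simps:
  "carrier (A_ring p q) = A_set p" "a \<otimes>\<^bsub>A_ring p q\<^esub> b = A_mult q a b"
  "a \<oplus>\<^bsub>A_ring p q\<^esub> b = (\<lambda>n. a n + b n)" "\<one>\<^bsub>A_ring p q\<^esub> = A_one"
  "\<zero>\<^bsub>A_ring p q\<^esub> = (\<lambda>_. 0)"
  by (simp_all add: A_ring_def)

lemma A_set_iff: "a \<in> A_set p \<longleftrightarrow> (\<forall>n. a n \<in> Zploc p)" by (simp add: A_set_def)

lemma A_mult_closed: "a \<in> A_set p \<Longrightarrow> b \<in> A_set p \<Longrightarrow> A_mult q a b \<in> A_set p"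
  using R.m_closed[of a b] by (simp add: A_ring_simps)

lemmas E_add = eval_seq_add[of q] and E_diff = eval_seq_diff[of q]
  and E_cmult = eval_seq_cmult[of q] and E_mult = eval_A_mult[OF abs_q]

lemma E_inject: "E a = E b \<longleftrightarrow> a = b"
  using inj_eval_seq[OF abs_q] by (simp add: inj_eq)

lemma E_scal: "E (scal r) = (\<lambda>_. r)"
proof
  fix i
  have "E (scal r) i = (\<Sum>n\<in>{0}. scal r n * ntheta q n i)"
    unfolding eval_seq_def by (intro sum.mono_neutral_right) (auto simp: scal_def)
  thus "E (scal r) i = r" by (simp add: scal_def)
qed

definition Phi :: "nat \<Rightarrow> nat \<Rightarrow> rat" where "Phi n = (\<lambda>k. if k = n then 1 else 0)"

lemma E_Phi: "E (Phi n) = ntheta q n"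
proof
  fix i
  have "E (Phi n) i = (\<Sum>k\<in>{n}. Phi n k * ntheta q k i)"
    unfolding eval_seq_extend[OF max.cobounded1[of i n]]
    by (intro sum.mono_neutral_right) (auto simp: Phi_def)
  thus "E (Phi n) i = ntheta q n i" by (simp add: Phi_def)
qed

lemma A_set_intros [simp]:
  "Phi n \<in> A_set p" "r \<in> Zploc p \<Longrightarrow> scal r \<in> A_set p" "A_one \<in> A_set p" "(\<lambda>_. 0) \<in> A_set p"
  "a \<in> A_set p \<Longrightarrow> b \<in> A_set p \<Longrightarrow> (\<lambda>n. a n + b n) \<in> A_set p"
  "a \<in> A_set p \<Longrightarrow> b \<in> A_set p \<Longrightarrow> (\<lambda>n. a n - b n) \<in> A_set p"
  "r \<in> Zploc p \<Longrightarrow> b \<in> A_set p \<Longrightarrow> (\<lambda>n. r * b n) \<in> A_set p"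
  "a \<in> A_set p \<Longrightarrow> b \<in> A_set p \<Longrightarrow> A_mult q a b \<in> A_set p"
  by (auto simp: A_set_iff Phi_def scal_def A_one_def A_mult_closed[unfolded A_set_iff])

lemma A_one_scal: "A_one = scal 1" by (simp add: A_one_def scal_def)

text \<open>From \<Phi>_1 = \<Psi>^q - q_1. As a function on the nodes it is the identity, sending
  each node to itself.\<close>

definition Psi :: "nat \<Rightarrow> rat" where "Psi = (\<lambda>n. Phi 1 n + scal (node q 0) n)"

lemma Psi_A_set [simp]: "Psi \<in> A_set p" by (simp add: Psi_def)

lemma E_Psi: "E Psi = node q"
  unfolding Psi_def E_add E_Phi E_scal using ntheta_Suc[of q 0] by auto

lemma act_E: "act (E a) x = a \<odot>\<^bsub>M\<^esub> x"
  using inj_eval_seq[OF abs_q] by (simp add: act_def)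

lemma eval_ring_E [simp]: "a \<in> A_set p \<Longrightarrow> E a \<in> eval_ring" by (simp add: eval_ring_def)

lemma eval_ring_cases: assumes "v \<in> eval_ring" obtains a where "v = E a" "a \<in> A_set p"
  using assms by (auto simp: eval_ring_def)

lemma eval_ring_const [simp]: "r \<in> Zploc p \<Longrightarrow> (\<lambda>_. r) \<in> eval_ring"
  using eval_ring_E[of "scal r"] by (simp add: E_scal)

lemma eval_ring_add [simp]: "u \<in> eval_ring \<Longrightarrow> v \<in> eval_ring \<Longrightarrow> (\<lambda>i. u i + v i) \<in> eval_ring"
  by (auto elim!: eval_ring_cases simp flip: E_add)

lemma eval_ring_diff [simp]: "u \<in> eval_ring \<Longrightarrow> v \<in> eval_ring \<Longrightarrow> (\<lambda>i. u i - v i) \<in> eval_ring"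
  by (auto elim!: eval_ring_cases simp flip: E_diff)

lemma eval_ring_mult [simp]: "u \<in> eval_ring \<Longrightarrow> v \<in> eval_ring \<Longrightarrow> (\<lambda>i. u i * v i) \<in> eval_ring"
  by (auto elim!: eval_ring_cases simp flip: E_mult)

lemma eval_ring_node [simp]: "node q \<in> eval_ring" using eval_ring_E[OF Psi_A_set] by (simp add: E_Psi)

lemma eval_ring_ntheta [simp]: "ntheta q n \<in> eval_ring" using eval_ring_E[of "Phi n"] by (simp add: E_Phi)

lemma eval_ring_prod_node [simp]: "(\<lambda>i. \<Prod>j\<in>{n..<n'}. node q i - node q j) \<in> eval_ring"
proof (cases "n \<le> n'")
  case True
  thus ?thesis by (induction n' rule: dec_induct) (auto simp: prod.atLeastLessThan_Suc)
qed simp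

lemma act_closed [simp]: "v \<in> eval_ring \<Longrightarrow> x \<in> carrier M \<Longrightarrow> act v x \<in> carrier M"
  by (auto elim!: eval_ring_cases simp: act_E A_ring_simps)

lemma act_add_left:
  "u \<in> eval_ring \<Longrightarrow> v \<in> eval_ring \<Longrightarrow> x \<in> carrier M \<Longrightarrow> act (\<lambda>i. u i + v i) x = act u x \<oplus>\<^bsub>M\<^esub> act v x"
  using smult_l_distr[of _ _ x] by (auto elim!: eval_ring_cases simp: act_E A_ring_simps simp flip: E_add)

lemma act_add_right:
  "u \<in> eval_ring \<Longrightarrow> x \<in> carrier M \<Longrightarrow> y \<in> carrier M \<Longrightarrow> act u (x \<oplus>\<^bsub>M\<^esub> y) = act u x \<oplus>\<^bsub>M\<^esub> act u y"
  using smult_r_distr[of _ x y] by (auto elim!: eval_ring_cases simp: act_E A_ring_simps)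

lemma act_mult:
  "u \<in> eval_ring \<Longrightarrow> v \<in> eval_ring \<Longrightarrow> x \<in> carrier M \<Longrightarrow> act u (act v x) = act (\<lambda>i. u i * v i) x"
  using smult_assoc1[of _ _ x] by (auto elim!: eval_ring_cases simp: act_E A_ring_simps simp flip: E_mult)

lemma act_one [simp]: "x \<in> carrier M \<Longrightarrow> act (\<lambda>_. 1) x = x"
  using smult_one[of x] act_E[of "scal 1" x] by (simp add: A_ring_simps A_one_scal E_scal)

lemma act_zero_left [simp]: "x \<in> carrier M \<Longrightarrow> act (\<lambda>_. 0) x = \<zero>\<^bsub>M\<^esub>"
  using smult_l_null[of x] act_E[of "scal 0" x]
  unfolding E_scal by (simp add: A_ring_simps scal_def)

lemma act_zero_right [simp]: "u \<in> eval_ring \<Longrightarrow> act u \<zero>\<^bsub>M\<^esub> = \<zero>\<^bsub>M\<^esub>"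
  using smult_r_null by (auto elim!: eval_ring_cases simp: act_E A_ring_simps)

lemma act_commute:
  "u \<in> eval_ring \<Longrightarrow> v \<in> eval_ring \<Longrightarrow> x \<in> carrier M \<Longrightarrow> act u (act v x) = act v (act u x)"
  by (simp add: act_mult mult.commute)

lemma act_minus_right:
  "u \<in> eval_ring \<Longrightarrow> x \<in> carrier M \<Longrightarrow> y \<in> carrier M \<Longrightarrow> act u (x \<ominus>\<^bsub>M\<^esub> y) = act u x \<ominus>\<^bsub>M\<^esub> act u y"
  using smult_r_distr[of _ x "\<ominus>\<^bsub>M\<^esub> y"] smult_r_minus[of _ y]
  by (auto elim!: eval_ring_cases simp: act_E A_ring_simps M.minus_eq)

lemma act_diff_left:
  assumes "u \<in> eval_ring" "v \<in> eval_ring" "x \<in> carrier M"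
  shows "act (\<lambda>i. u i - v i) x = act u x \<ominus>\<^bsub>M\<^esub> act v x"
proof -
  have "act (\<lambda>i. u i - v i) x \<oplus>\<^bsub>M\<^esub> act v x = act u x"
    using assms act_add_left[of "\<lambda>i. u i - v i" v x] by simp
  hence "act u x \<ominus>\<^bsub>M\<^esub> act v x = act (\<lambda>i. u i - v i) x \<oplus>\<^bsub>M\<^esub> act v x \<ominus>\<^bsub>M\<^esub> act v x" by simp
  also have "\<dots> = act (\<lambda>i. u i - v i) x"
    using assms by (simp add: M.minus_eq M.a_assoc M.r_neg)
  finally show ?thesis ..
qed

lemma add_pow_act: "x \<in> carrier M \<Longrightarrow> add_pow M (n::nat) x = act (\<lambda>_. of_nat n) x"
  by (induction n) (simp_all add: act_add_left M.add.m_comm)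

text \<open>These increasing submodules exhaust M by discreteness. On the m-th one, A acts through
  the values at the first m nodes only.\<close>

definition killed :: "nat \<Rightarrow> 'm set" where
  "killed m = {x \<in> carrier M. \<forall>a\<in>A_filt p m. a \<odot>\<^bsub>M\<^esub> x = \<zero>\<^bsub>M\<^esub>}"

lemma A_filt_iff: "a \<in> A_filt p m \<longleftrightarrow> a \<in> A_set p \<and> (\<forall>i<m. E a i = 0)"
  using eval_seq_zero_iff[OF abs_q, of m a] by (auto simp: A_filt_def)

lemma killed_iff: "x \<in> killed m \<longleftrightarrow> x \<in> carrier M \<and> (\<forall>v\<in>eval_ring. (\<forall>i<m. v i = 0) \<longrightarrow> act v x = \<zero>\<^bsub>M\<^esub>)"
  by (auto simp: killed_def A_filt_iff eval_ring_def act_E)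

lemma killed_closed [simp]: "x \<in> killed m \<Longrightarrow> x \<in> carrier M" by (simp add: killed_iff)

text \<open>The difference of u and v lies in A_m. Nearly every identity in M below is obtained here
  from an identity of rational numbers at finitely many nodes.\<close>

lemma killed_cong:
  assumes "x \<in> killed m" "u \<in> eval_ring" "v \<in> eval_ring" "\<And>i. i < m \<Longrightarrow> u i = v i"
  shows "act u x = act v x"
proof -
  have "act (\<lambda>i. u i - v i) x = \<zero>\<^bsub>M\<^esub>" using assms by (auto simp: killed_iff)
  moreover have "act (\<lambda>i. u i - v i) x \<oplus>\<^bsub>M\<^esub> act v x = act u x"
    using assms act_add_left[of "\<lambda>i. u i - v i" v x] by simp
  ultimately show ?thesis using assms by simp
qed

lemma killed_zero [simp]: "\<zero>\<^bsub>M\<^esub> \<in> killed m" by (simp add: killed_iff)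

lemma killed_add [simp]: "x \<in> killed m \<Longrightarrow> y \<in> killed m \<Longrightarrow> x \<oplus>\<^bsub>M\<^esub> y \<in> killed m"
  by (simp add: killed_iff act_add_right)

lemma killed_diff [simp]: "x \<in> killed m \<Longrightarrow> y \<in> killed m \<Longrightarrow> x \<ominus>\<^bsub>M\<^esub> y \<in> killed m"
  by (simp add: killed_iff act_minus_right) (simp add: M.minus_eq)

lemma killed_act [simp]: "x \<in> killed m \<Longrightarrow> u \<in> eval_ring \<Longrightarrow> act u x \<in> killed m"
  by (simp add: killed_iff act_mult)

lemma killed_mono: "x \<in> killed m \<Longrightarrow> m \<le> m' \<Longrightarrow> x \<in> killed m'"
  by (auto simp: killed_iff)

lemma killed_exists: "x \<in> carrier M \<Longrightarrow> \<exists>m. x \<in> killed m"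
  using discrete unfolding A_discrete_def killed_def by blast

section \<open>Interpolation at finitely many nodes by elements of A\<close>

lemma interpolation: "\<exists>a. \<forall>i<m. E a i = v i"
proof (induction m)
  case (Suc m)
  then obtain a where a: "\<forall>i<m. E a i = v i" by blast
  \<comment> \<open>Newton interpolation: the coefficient with index m does not affect the values at
    earlier nodes, and its factor \<open>ntheta q m m\<close> at node m is nonzero.\<close>
  define a' where "a' = a(m := a m + (v m - E a m) / ntheta q m m)"
  have "E a' i = v i" if "i < m" for i using a that eval_seq_cong[of i a' a q] by (simp add: a'_def)
  moreover have "E a' m = E a m + (v m - E a m) / ntheta q m m * ntheta q m m"
  proof -
    have "E a' m = (\<Sum>n<m. a n * ntheta q n m) + a' m * ntheta q m m"
      by (simp add: eval_seq_def a'_def lessThan_Suc_atMost[symmetric])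
    moreover have "E a m = (\<Sum>n<m. a n * ntheta q n m) + a m * ntheta q m m"
      by (simp add: eval_seq_def lessThan_Suc_atMost[symmetric])
    ultimately show ?thesis by (simp add: a'_def ring_distribs)
  qed
  ultimately have "\<forall>i<Suc m. E a' i = v i" using ntheta_neq_0[OF abs_q, of m m] by (auto simp: less_Suc_eq)
  thus ?case by blast
qed simp

lemma common_denominator: "\<exists>d::nat. d > 0 \<and> (\<forall>n<m::nat. \<exists>z::int. of_nat d * (a n :: rat) = of_int z)"
proof (induction m)
  case (Suc m)
  then obtain d :: nat where d: "d > 0" "\<forall>n<m. \<exists>z::int. of_nat d * a n = of_int z" by blast
  obtain x y where xy: "a m = of_int x / of_int y" "y > 0"
    by (metis quotient_of_denom_pos quotient_of_div surj_pair)
  have "\<exists>z::int. of_nat (d * nat y) * a n = of_int z" if "n < Suc m" for n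
  proof (cases "n = m")
    case True
    show ?thesis by (rule exI[of _ "int d * x"]) (use xy True in simp)
  next
    case False
    with that have "n < m" by simp
    then obtain z :: int where "of_nat d * a n = of_int z" using d by blast
    thus ?thesis using xy by (intro exI[of _ "z * y"]) (simp add: algebra_simps)
  qed
  thus ?case using d xy by (intro exI[of _ "d * nat y"]) auto
qed auto

lemma eval_ring_interpolation: "\<exists>d::nat. d > 0 \<and> (\<exists>b\<in>eval_ring. \<forall>i<m. b i = of_nat d * v i)"
proof -
  obtain a where a: "\<forall>i<m. E a i = v i" using interpolation by blast
  obtain d :: nat where d: "d > 0" "\<forall>n<m. \<exists>z::int. of_nat d * a n = of_int z"
    using common_denominator by blast
  \<comment> \<open>Coefficients from m on are irrelevant at the first m nodes; cutting them off
    leaves finitely many denominators to clear.\<close>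
  define a' where "a' n = (if n < m then of_nat d * a n else 0)" for n
  have "a' \<in> A_set p" using d by (fastforce simp: A_set_iff a'_def)
  moreover have "E a' i = of_nat d * v i" if "i < m" for i
    using a that eval_seq_cong[of i a' "\<lambda>n. of_nat d * a n" q] by (simp add: a'_def E_cmult)
  ultimately show ?thesis using d eval_ring_E by blast
qed

text \<open>One multiplier d serves all the functions, so that a sum of their actions can be divided
  by it as a whole.\<close>

lemma eval_ring_interpolation_family:
  "\<exists>d::nat. d > 0 \<and> (\<forall>n<N::nat. \<exists>b\<in>eval_ring. \<forall>i<m. b i = of_nat d * v n i)"
proof (induction N)
  case (Suc N)
  then obtain d :: nat where d: "d > 0" "\<forall>n<N. \<exists>b\<in>eval_ring. \<forall>i<m. b i = of_nat d * v n i" by blast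
  obtain e b where e: "(e::nat) > 0" "b \<in> eval_ring" "\<forall>i<m. b i = of_nat e * v N i" using eval_ring_interpolation by blast
  have "\<exists>b\<in>eval_ring. \<forall>i<m. b i = of_nat (d * e) * v n i" if "n < Suc N" for n
  proof (cases "n = N")
    case True
    thus ?thesis using e by (intro bexI[of _ "\<lambda>i. of_nat d * b i"]) auto
  next
    case False
    with that have "n < N" by simp
    then obtain b' where "b' \<in> eval_ring" "\<forall>i<m. b' i = of_nat d * v n i" using d by blast
    thus ?thesis by (intro bexI[of _ "\<lambda>i. of_nat e * b' i"]) auto
  qed
  thus ?case using d e by (intro exI[of _ "d * e"]) auto
qed auto

text \<open>Modulo p^k the factors of \<Theta>_l are collected one at a time: once a block of
  factors is a multiple of \<Theta>_l, it is prolonged to an index j whose node is congruent to node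
  l, and the last factor x - q_j supplies the missing factor of \<Theta>_(l+1).\<close>

lemma node_product_mod_power:
  "\<exists>n'\<ge>n. \<exists>b\<in>eval_ring. \<exists>c\<in>eval_ring. \<forall>i. (\<Prod>j\<in>{n..<n'}. node q i - node q j) = b i * ntheta q l i + of_nat p ^ k * c i"
proof (induction l)
  case 0
  show ?case by (rule exI[of _ n], rule conjI[OF order.refl], rule bexI[of _ "\<lambda>_. 1"],
      rule bexI[of _ "\<lambda>_. 0"]) auto
next
  case (Suc l)
  then obtain n' b c where n': "n' \<ge> n" "b \<in> eval_ring" "c \<in> eval_ring"
    "\<And>i. (\<Prod>j\<in>{n..<n'}. node q i - node q j) = b i * ntheta q l i + of_nat p ^ k * c i" by blast
  obtain j u where j: "j \<ge> n'" "u \<in> Zploc p" "node q j = node q l + of_nat p ^ k * u"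
    using node_recurs[OF prime_p not_dvd] by blast
  define P where "P i = (\<Prod>j\<in>{n'..<j}. node q i - node q j)" for i
  have P: "P \<in> eval_ring" unfolding P_def by simp
  define b' where "b' i = P i * b i" for i
  \<comment> \<open>Obtained by substituting node j = node l + p^k u in the last factor: its main
    part enters \<open>b'\<close>, and the term with u joins the old remainder.\<close>
  define c' where "c' i = (node q i - node q j) * (P i * c i) - u * (P i * (b i * ntheta q l i))" for i
  have "b' \<in> eval_ring" "c' \<in> eval_ring" using P n' j unfolding b'_def c'_def by auto
  moreover have "(\<Prod>j\<in>{n..<Suc j}. node q i - node q j) = b' i * ntheta q (Suc l) i + of_nat p ^ k * c' i" for i
  proof -
    have "(\<Prod>j\<in>{n..<Suc j}. node q i - node q j) = (\<Prod>j\<in>{n..<n'}. node q i - node q j) * P i * (node q i - node q j)"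
      using n' j prod.atLeastLessThan_concat[of n n' j "\<lambda>j. node q i - node q j"] by (simp add: P_def)
    thus ?thesis unfolding n'(4) b'_def c'_def ntheta_Suc j(3) by (simp add: algebra_simps)
  qed
  moreover have "Suc j \<ge> n" using n' j by simp
  ultimately show ?case by blast
qed

section \<open>The rationalisation\<close>

abbreviation nact :: "nat \<Rightarrow> 'm \<Rightarrow> 'm" where "nact n \<equiv> act (\<lambda>_. of_nat n)"

lemma nact_nact: "x \<in> carrier M \<Longrightarrow> nact m (nact n x) = nact (m * n) x"
  by (simp add: act_mult)

lemma MQ_rel_iff: "((x, s), (y, t)) \<in> MQ_rel M \<longleftrightarrow> x \<in> carrier M \<and> y \<in> carrier M \<and> s > 0 \<and> t > 0 \<and>
    (\<exists>u>0. nact (u * t) x = nact (u * s) y)"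
  by (auto simp: MQ_rel_def add_pow_act)

text \<open>Torsion forbids cancelling the middle denominator t in the proof of transitivity; it is
  absorbed into the witness \<open>u * v * t\<close>.\<close>

lemma equiv_MQ_rel: "equiv (carrier M \<times> {s. s > 0}) (MQ_rel M)"
proof (rule equivI)
  show "MQ_rel M \<subseteq> (carrier M \<times> {s. s > 0}) \<times> (carrier M \<times> {s. s > 0})"
    by (auto simp: MQ_rel_def)
  show "refl_on (carrier M \<times> {s. s > 0}) (MQ_rel M)"
    by (auto simp: refl_on_def MQ_rel_iff)
  show "sym (MQ_rel M)"
  proof (rule symI, unfold split_paired_all)
    fix x s y t assume "((x, s), y, t) \<in> MQ_rel M"
    thus "((y, t), x, s) \<in> MQ_rel M" unfolding MQ_rel_iff by metis
  qed
  show "trans (MQ_rel M)"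
  proof (rule transI, unfold split_paired_all)
    fix x s y t z r
    assume "((x, s), y, t) \<in> MQ_rel M" "((y, t), z, r) \<in> MQ_rel M"
    then obtain u v where *: "x \<in> carrier M" "y \<in> carrier M" "z \<in> carrier M" "s > 0" "t > 0" "r > 0"
      "u > 0" "v > 0" "nact (u * t) x = nact (u * s) y" "nact (v * r) y = nact (v * t) z"
      by (auto simp: MQ_rel_iff)
    have "nact (u * v * t * r) x = nact (v * r) (nact (u * t) x)" using *(1-3) by (simp only: nact_nact ac_simps)
    also have "\<dots> = nact (u * s) (nact (v * r) y)" unfolding *(9) using *(1-3) by (simp only: nact_nact ac_simps)
    also have "\<dots> = nact (u * v * t * s) z" unfolding *(10) using *(1-3) by (simp only: nact_nact ac_simps)
    finally show "((x, s), z, r) \<in> MQ_rel M" using *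
      unfolding MQ_rel_iff by (intro conjI exI[of _ "u * v * t"]) auto
  qed
qed

lemma MQ_class_eq_iff:
  "x \<in> carrier M \<Longrightarrow> y \<in> carrier M \<Longrightarrow> s > 0 \<Longrightarrow> t > 0 \<Longrightarrow>
    MQ_class M x s = MQ_class M y t \<longleftrightarrow> (\<exists>u>0. nact (u * t) x = nact (u * s) y)"
  unfolding MQ_class_def using eq_equiv_class_iff[OF equiv_MQ_rel, of "(x, s)" "(y, t)"]
  by (simp add: MQ_rel_iff)

lemma MQ_class_eqI:
  "x \<in> carrier M \<Longrightarrow> y \<in> carrier M \<Longrightarrow> s > 0 \<Longrightarrow> t > 0 \<Longrightarrow> nact t x = nact s y \<Longrightarrow>
    MQ_class M x s = MQ_class M y t"
  by (subst MQ_class_eq_iff) (auto intro!: exI[of _ 1])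

lemma MQ_class_self: "x \<in> carrier M \<Longrightarrow> s > 0 \<Longrightarrow> (x, s) \<in> MQ_class M x s"
  unfolding MQ_class_def using equiv_class_self[OF equiv_MQ_rel] by simp

lemma MQ_class_memD:
  assumes "(y, t) \<in> MQ_class M x s"
  shows "y \<in> carrier M" "t > 0" "\<exists>u>0. nact (u * t) x = nact (u * s) y"
  using assms by (auto simp: MQ_class_def MQ_rel_iff)

lemma carrier_MQ: "X \<in> carrier (MQ M) \<longleftrightarrow> (\<exists>x s. x \<in> carrier M \<and> s > 0 \<and> X = MQ_class M x s)"
  by (auto simp: MQ_def quotient_def MQ_class_def)

lemma MQ_class_closed [simp]: "x \<in> carrier M \<Longrightarrow> s > 0 \<Longrightarrow> MQ_class M x s \<in> carrier (MQ M)"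
  by (auto simp: carrier_MQ)

lemma zero_MQ: "\<zero>\<^bsub>MQ M\<^esub> = MQ_class M \<zero>\<^bsub>M\<^esub> 1"
  by (simp add: MQ_def)

lemma MQ_class_eq_zero_iff:
  "x \<in> carrier M \<Longrightarrow> s > 0 \<Longrightarrow> MQ_class M x s = \<zero>\<^bsub>MQ M\<^esub> \<longleftrightarrow> (\<exists>u>0. nact u x = \<zero>\<^bsub>M\<^esub>)"
  by (simp add: zero_MQ MQ_class_eq_iff)

text \<open>Operations on classes are defined as unions over representatives; once all
  representatives give the same class, the union is that class.\<close>

lemma UN_constant_mem: "a \<in> A \<Longrightarrow> (\<And>x. x \<in> A \<Longrightarrow> f x = c) \<Longrightarrow> (\<Union>x\<in>A. f x) = c"
  by auto

lemma add_MQ: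
  assumes "x \<in> carrier M" "y \<in> carrier M" "s > 0" "t > 0"
  shows "MQ_class M x s \<oplus>\<^bsub>MQ M\<^esub> MQ_class M y t = MQ_class M (nact t x \<oplus>\<^bsub>M\<^esub> nact s y) (s * t)"
proof -
  let ?c = "MQ_class M (nact t x \<oplus>\<^bsub>M\<^esub> nact s y) (s * t)"
  have *: "MQ_class M (add_pow M t' x' \<oplus>\<^bsub>M\<^esub> add_pow M s' y') (s' * t') = ?c"
    if "(x', s') \<in> MQ_class M x s" "(y', t') \<in> MQ_class M y t" for x' s' y' t'
  proof -
    note mem = MQ_class_memD[OF that(1)] MQ_class_memD[OF that(2)]
    obtain u v where uv: "u > 0" "v > 0" "nact (u * s') x = nact (u * s) x'"
      "nact (v * t') y = nact (v * t) y'" using mem by blast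
    have 1: "nact (u * v * (s * t)) (nact t' x') = nact (u * v * (s' * t')) (nact t x)"
    proof -
      have "nact (u * v * (s * t)) (nact t' x') = nact (v * t * t') (nact (u * s) x')"
        using mem(1,4) by (simp only: nact_nact ac_simps)
      also have "\<dots> = nact (v * t * t') (nact (u * s') x)" by (simp only: uv(3))
      also have "\<dots> = nact (u * v * (s' * t')) (nact t x)" using assms(1,2) by (simp only: nact_nact ac_simps)
      finally show ?thesis .
    qed
    have 2: "nact (u * v * (s * t)) (nact s' y') = nact (u * v * (s' * t')) (nact s y)"
    proof -
      have "nact (u * v * (s * t)) (nact s' y') = nact (u * s * s') (nact (v * t) y')"
        using mem(1,4) by (simp only: nact_nact ac_simps)
      also have "\<dots> = nact (u * s * s') (nact (v * t') y)" by (simp only: uv(4))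
      also have "\<dots> = nact (u * v * (s' * t')) (nact s y)" using assms(1,2) by (simp only: nact_nact ac_simps)
      finally show ?thesis .
    qed
    show ?thesis unfolding add_pow_act[OF mem(1)] add_pow_act[OF mem(4)]
    proof (subst MQ_class_eq_iff)
      show "\<exists>w>0. nact (w * (s * t)) (nact t' x' \<oplus>\<^bsub>M\<^esub> nact s' y') =
          nact (w * (s' * t')) (nact t x \<oplus>\<^bsub>M\<^esub> nact s y)"
        using mem assms uv 1 2 by (intro exI[of _ "u * v"]) (simp add: act_add_right del: of_nat_mult)
    qed (use mem assms in auto)
  qed
  show ?thesis unfolding MQ_def ring.simps
    by (rule UN_constant_mem[OF MQ_class_self[OF assms(1,3)]], unfold split_paired_all case_prod_conv,
        rule UN_constant_mem[OF MQ_class_self[OF assms(2,4)]], unfold split_paired_all case_prod_conv,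
        rule *)
qed

lemma smult_MQ:
  assumes "a \<in> A_set p" "x \<in> carrier M" "s > 0"
  shows "a \<odot>\<^bsub>MQ M\<^esub> MQ_class M x s = MQ_class M (act (E a) x) s"
proof -
  have *: "MQ_class M (a \<odot>\<^bsub>M\<^esub> x') s' = MQ_class M (act (E a) x) s"
    if "(x', s') \<in> MQ_class M x s" for x' s'
  proof -
    note mem = MQ_class_memD[OF that]
    then obtain u where u: "u > 0" "nact (u * s') x = nact (u * s) x'" by blast
    have "nact (u * s) (act (E a) x') = act (E a) (nact (u * s') x)"
      using assms mem u by (simp add: act_commute del: of_nat_mult)
    hence "nact (u * s) (act (E a) x') = nact (u * s') (act (E a) x)"
      using assms by (simp add: act_commute del: of_nat_mult)
    thus ?thesis using mem assms u unfolding act_E[symmetric] by (subst MQ_class_eq_iff) auto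
  qed
  show ?thesis unfolding MQ_def module.simps
    by (rule UN_constant_mem[OF MQ_class_self[OF assms(2,3)]], unfold split_paired_all case_prod_conv,
        rule *)
qed

section \<open>Continuous homomorphisms\<close>

abbreviation U :: "((nat \<Rightarrow> rat) \<Rightarrow> 'm) set" where "U \<equiv> UM_carrier p M"

lemma UM_sel:
  "carrier (UM p q M) = U" "\<zero>\<^bsub>UM p q M\<^esub> = (\<lambda>t\<in>A_set p. \<zero>\<^bsub>M\<^esub>)"
  "f \<oplus>\<^bsub>UM p q M\<^esub> g = (\<lambda>t\<in>A_set p. f t \<oplus>\<^bsub>M\<^esub> g t)"
  "a \<odot>\<^bsub>UM p q M\<^esub> f = (\<lambda>t\<in>A_set p. f (A_mult q t a))"
  by (simp_all add: UM_def)

lemma U_closed [simp]: "f \<in> U \<Longrightarrow> t \<in> A_set p \<Longrightarrow> f t \<in> carrier M"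
  by (auto simp: UM_carrier_def)

lemma U_add: "f \<in> U \<Longrightarrow> s \<in> A_set p \<Longrightarrow> t \<in> A_set p \<Longrightarrow> f (\<lambda>n. s n + t n) = f s \<oplus>\<^bsub>M\<^esub> f t"
  unfolding UM_carrier_def by blast

lemma scal_smult: "scal r \<odot>\<^bsub>M\<^esub> x = act (\<lambda>_. r) x"
  using act_E[of "scal r" x] by (simp add: E_scal)

lemma U_scal: "f \<in> U \<Longrightarrow> r \<in> Zploc p \<Longrightarrow> t \<in> A_set p \<Longrightarrow> f (\<lambda>n. r * t n) = act (\<lambda>_. r) (f t)"
  unfolding UM_carrier_def scal_smult by blast

lemma U_continuous: "f \<in> U \<Longrightarrow> \<exists>n. \<forall>t\<in>A_filt p n. f t = \<zero>\<^bsub>M\<^esub>"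
  unfolding UM_carrier_def by blast

lemma U_extensional: "f \<in> U \<Longrightarrow> f \<in> extensional (A_set p)"
  unfolding UM_carrier_def by blast

lemma U_restrictI:
  assumes "\<And>t. t \<in> A_set p \<Longrightarrow> f t \<in> carrier M"
    and "\<And>s t. s \<in> A_set p \<Longrightarrow> t \<in> A_set p \<Longrightarrow> f (\<lambda>n. s n + t n) = f s \<oplus>\<^bsub>M\<^esub> f t"
    and "\<And>r t. r \<in> Zploc p \<Longrightarrow> t \<in> A_set p \<Longrightarrow> f (\<lambda>n. r * t n) = act (\<lambda>_. r) (f t)"
    and "\<And>t. t \<in> A_filt p n \<Longrightarrow> f t = \<zero>\<^bsub>M\<^esub>"
  shows "restrict f (A_set p) \<in> U"
  unfolding UM_carrier_def using assms by (auto simp: scal_smult A_filt_def intro!: exI[of _ n])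

section \<open>Continuous homomorphisms as finitely supported sequences\<close>

lemma A_filt_subset: "t \<in> A_filt p n \<Longrightarrow> t \<in> A_set p" by (simp add: A_filt_def)

lemma A_filt_mono: "t \<in> A_filt p n \<Longrightarrow> m \<le> n \<Longrightarrow> t \<in> A_filt p m" by (simp add: A_filt_def)

lemma A_filt_mult: "t \<in> A_filt p n \<Longrightarrow> a \<in> A_set p \<Longrightarrow> A_mult q t a \<in> A_filt p n"
  by (simp add: A_filt_iff E_mult)

lemma Phi_apply: "Phi n k = (if k = n then 1 else 0)" by (simp add: Phi_def)

lemma Phi_A_filt: "m \<le> n \<Longrightarrow> Phi n \<in> A_filt p m" by (auto simp: A_filt_def) (simp add: Phi_def)

lemma U_zero: assumes "f \<in> U" shows "f (\<lambda>_. 0) = \<zero>\<^bsub>M\<^esub>"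
  using U_scal[OF assms, of 0 "\<lambda>_. 0"] assms by simp

definition trunc :: "nat \<Rightarrow> (nat \<Rightarrow> rat) \<Rightarrow> nat \<Rightarrow> rat" where
  "trunc K t n = (if n < K then t n else 0)"

lemma trunc_A_set [simp]: "t \<in> A_set p \<Longrightarrow> trunc K t \<in> A_set p"
  by (simp add: A_set_iff trunc_def)

lemma trunc_0: "trunc 0 t = (\<lambda>_. 0)" by (simp add: trunc_def fun_eq_iff)

lemma trunc_Suc: "trunc (Suc K) t = (\<lambda>n. trunc K t n + t K * Phi K n)"
  by (auto simp: trunc_def Phi_def fun_eq_iff less_Suc_eq)

lemma A_set_coord [simp]: "t \<in> A_set p \<Longrightarrow> t n \<in> Zploc p" by (simp add: A_set_iff)

lemma U_trunc_Suc:
  "f \<in> U \<Longrightarrow> t \<in> A_set p \<Longrightarrow> f (trunc (Suc K) t) = f (trunc K t) \<oplus>\<^bsub>M\<^esub> act (\<lambda>_. t K) (f (Phi K))"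
  unfolding trunc_Suc
  using U_add[of f "trunc K t" "\<lambda>n. t K * Phi K n"] U_scal[of f "t K" "Phi K"] by simp

lemma trunc_tail: "t \<in> A_set p \<Longrightarrow> (\<lambda>n. t n - trunc K t n) \<in> A_filt p K"
  by (simp add: A_filt_def) (simp add: trunc_def)

lemma U_trunc:
  assumes "f \<in> U" "t \<in> A_set p" "\<forall>t\<in>A_filt p K. f t = \<zero>\<^bsub>M\<^esub>"
  shows "f (trunc K t) = f t"
  using U_add[OF assms(1), of "trunc K t" "\<lambda>n. t n - trunc K t n"] trunc_tail[of t K] assms by simp

text \<open>By continuity both maps see only a truncation of t, which is a finite combination of the
  \<open>Phi n\<close>.\<close>

lemma U_eqI:
  assumes "f \<in> U" "g \<in> U" "\<And>n. f (Phi n) = g (Phi n)"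
  shows "f = g"
proof (rule extensionalityI[OF U_extensional U_extensional, OF assms(1,2)])
  fix t assume t: "t \<in> A_set p"
  obtain m n where mn: "\<forall>t\<in>A_filt p m. f t = \<zero>\<^bsub>M\<^esub>" "\<forall>t\<in>A_filt p n. g t = \<zero>\<^bsub>M\<^esub>"
    using U_continuous assms by metis
  have "f (trunc K t) = g (trunc K t)" for K
    by (induction K) (use t assms in \<open>simp_all add: trunc_0 U_zero U_trunc_Suc\<close>)
  moreover have "f (trunc (max m n) t) = f t" "g (trunc (max m n) t) = g t"
    using mn t assms A_filt_mono by (auto intro!: U_trunc)
  ultimately show "f t = g t" by metis
qed

text \<open>One level serves two purposes: f_n = 0 for n \<ge> m, so that sums over n < m are
  complete, and the values lie in \<open>killed m\<close>, so that interpolation at m nodes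
  determines the action on them.\<close>

definition good :: "nat \<Rightarrow> ((nat \<Rightarrow> rat) \<Rightarrow> 'm) \<Rightarrow> bool" where
  "good m f \<longleftrightarrow> f \<in> U \<and> (\<forall>t\<in>A_filt p m. f t = \<zero>\<^bsub>M\<^esub>) \<and> (\<forall>t\<in>A_set p. f t \<in> killed m)"

lemma good_mono: "good m f \<Longrightarrow> m \<le> m' \<Longrightarrow> good m' f"
  unfolding good_def using A_filt_mono killed_mono by blast

lemma goodD:
  assumes "good m f"
  shows "f \<in> U" "t \<in> A_filt p m \<Longrightarrow> f t = \<zero>\<^bsub>M\<^esub>" "t \<in> A_set p \<Longrightarrow> f t \<in> killed m"
  using assms by (auto simp: good_def)

text \<open>Up to a truncation, all values of f are combinations of finitely many f(\<Phi>_k), and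
  each of these is killed by some step of the filtration.\<close>

lemma good_exists: assumes "f \<in> U" shows "\<exists>m. good m f"
proof -
  obtain K where K: "\<forall>t\<in>A_filt p K. f t = \<zero>\<^bsub>M\<^esub>" using U_continuous assms by blast
  have "\<exists>m. \<forall>t\<in>A_set p. f (trunc k t) \<in> killed m" for k
  proof (induction k)
    case 0
    show ?case using assms by (simp add: trunc_0 U_zero)
  next
    case (Suc k)
    then obtain m where m: "\<forall>t\<in>A_set p. f (trunc k t) \<in> killed m" by blast
    obtain n where n: "f (Phi k) \<in> killed n" using killed_exists assms by force
    have "f (trunc (Suc k) t) \<in> killed (max m n)" if "t \<in> A_set p" for t
      using that m n killed_mono[of _ m "max m n"] killed_mono[of _ n "max m n"] assms
      by (simp add: U_trunc_Suc)
    thus ?case by blast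
  qed
  then obtain m where m: "\<forall>t\<in>A_set p. f (trunc K t) \<in> killed m" by blast
  have "f t \<in> killed (max m K)" if "t \<in> A_set p" for t
    using that m U_trunc[OF assms that K] killed_mono[of "f t" m "max m K"] by auto
  moreover have "\<forall>t\<in>A_filt p (max m K). f t = \<zero>\<^bsub>M\<^esub>" using K A_filt_mono by auto
  ultimately show ?thesis unfolding good_def using assms by blast
qed

lemma good_common: "f \<in> U \<Longrightarrow> g \<in> U \<Longrightarrow> \<exists>m. good m f \<and> good m g"
  using good_exists good_mono by (metis max.cobounded1 max.cobounded2)

lemma finsum_lessThan_Suc:
  "(\<And>n. f n \<in> carrier M) \<Longrightarrow> finsum M f {..<Suc k} = finsum M f {..<k} \<oplus>\<^bsub>M\<^esub> f k"
  unfolding lessThan_Suc by (subst M.finsum_insert) (auto intro: M.a_comm)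

lemma finsum_closed': "(\<And>n. f n \<in> carrier M) \<Longrightarrow> finsum M f A \<in> carrier M"
  by (rule M.finsum_closed) auto

lemma act_finsum:
  "u \<in> eval_ring \<Longrightarrow> (\<And>n. f n \<in> carrier M) \<Longrightarrow> act u (finsum M f {..<k::nat}) = finsum M (\<lambda>n. act u (f n)) {..<k}"
  by (induction k) (simp_all add: finsum_lessThan_Suc act_add_right finsum_closed')

lemma finsum_zero: "(\<And>n. n < k \<Longrightarrow> f n = \<zero>\<^bsub>M\<^esub>) \<Longrightarrow> finsum M f {..<k::nat} = \<zero>\<^bsub>M\<^esub>"
  by (rule M.add.finprod_one_eqI) auto

text \<open>The converse of \<open>U_eqI\<close>: t is sent to the sum of the t_n x_n, which is
  finite by the support condition.\<close>

lemma U_of_sequence: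
  assumes "\<And>n. x n \<in> carrier M" "\<And>n. n \<ge> K \<Longrightarrow> x n = \<zero>\<^bsub>M\<^esub>"
  shows "\<exists>f\<in>U. \<forall>n. f (Phi n) = x n"
proof -
  define F where "F k t = finsum M (\<lambda>n. act (\<lambda>_. t n) (x n)) {..<k}" for k and t :: "nat \<Rightarrow> rat"
  have F_Suc: "F (Suc k) t = F k t \<oplus>\<^bsub>M\<^esub> act (\<lambda>_. t k) (x k)" if "t \<in> A_set p" for k t
    unfolding F_def using assms that by (intro finsum_lessThan_Suc) auto
  have F_0: "F 0 t = \<zero>\<^bsub>M\<^esub>" for t by (simp add: F_def)
  have F_closed: "F k t \<in> carrier M" if "t \<in> A_set p" for k t
    unfolding F_def using assms that by (intro finsum_closed') auto
  have F_add: "F k (\<lambda>n. s n + t n) = F k s \<oplus>\<^bsub>M\<^esub> F k t" if "s \<in> A_set p" "t \<in> A_set p" for k s t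
    by (induction k) (use that assms F_closed in \<open>simp_all add: F_0 F_Suc act_add_left M.add.m_ac\<close>)
  have F_scal: "F k (\<lambda>n. r * t n) = act (\<lambda>_. r) (F k t)" if "r \<in> Zploc p" "t \<in> A_set p" for k r t
    by (induction k) (use that assms F_closed in \<open>simp_all add: F_0 F_Suc act_add_right act_mult\<close>)
  have "F K t = \<zero>\<^bsub>M\<^esub>" if "t \<in> A_filt p K" for t
    unfolding F_def using assms that by (intro finsum_zero) (auto simp: A_filt_def)
  hence "restrict (F K) (A_set p) \<in> U"
    using F_closed F_add F_scal by (intro U_restrictI) auto
  moreover have "F (Suc k) (Phi n) = F k (Phi n) \<oplus>\<^bsub>M\<^esub> (if k = n then x n else \<zero>\<^bsub>M\<^esub>)" for n k
  proof -
    have "act (\<lambda>_. Phi n k) (x k) = (if k = n then x n else \<zero>\<^bsub>M\<^esub>)"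
      unfolding Phi_apply using assms(1) by simp
    thus ?thesis by (simp add: F_Suc)
  qed
  hence "F k (Phi n) = (if n < k then x n else \<zero>\<^bsub>M\<^esub>)" for n k
    by (induction k) (use assms(1) in \<open>auto simp: F_0 less_Suc_eq\<close>)
  hence "F K (Phi n) = x n" for n using assms by auto
  ultimately show ?thesis by (intro bexI[of _ "restrict (F K) (A_set p)"]) auto
qed

lemma minus_add_cancel: "x \<in> carrier M \<Longrightarrow> y \<in> carrier M \<Longrightarrow> (x \<ominus>\<^bsub>M\<^esub> y) \<oplus>\<^bsub>M\<^esub> y = x"
  by (simp add: M.minus_eq M.a_assoc M.l_neg)

lemma minus_eq_zero_iff:
  "x \<in> carrier M \<Longrightarrow> y \<in> carrier M \<Longrightarrow> x \<ominus>\<^bsub>M\<^esub> y = \<zero>\<^bsub>M\<^esub> \<longleftrightarrow> x = y"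
  using minus_add_cancel[of x y] by (auto simp: M.minus_eq M.r_neg)

lemma minus_add_distrib:
  "a \<in> carrier M \<Longrightarrow> b \<in> carrier M \<Longrightarrow> c \<in> carrier M \<Longrightarrow> d \<in> carrier M \<Longrightarrow>
    (a \<oplus>\<^bsub>M\<^esub> b) \<ominus>\<^bsub>M\<^esub> (c \<oplus>\<^bsub>M\<^esub> d) = (a \<ominus>\<^bsub>M\<^esub> c) \<oplus>\<^bsub>M\<^esub> (b \<ominus>\<^bsub>M\<^esub> d)"
  by (simp add: M.minus_eq M.minus_add M.a_ac)

section \<open>Identities in A, verified pointwise at the nodes\<close>

lemma A_mult_add_left: "A_mult q (\<lambda>n. s n + t n) a = (\<lambda>n. A_mult q s a n + A_mult q t a n)"
  by (subst E_inject[symmetric]) (simp only: E_mult E_add ring_distribs)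

lemma A_mult_add_right: "A_mult q a (\<lambda>n. s n + t n) = (\<lambda>n. A_mult q a s n + A_mult q a t n)"
  by (subst E_inject[symmetric]) (simp only: E_mult E_add ring_distribs)

lemma A_mult_cmult_left: "A_mult q (\<lambda>n. r * t n) a = (\<lambda>n. r * A_mult q t a n)"
  by (subst E_inject[symmetric]) (simp only: E_mult E_cmult mult.assoc)

lemma A_mult_assoc: "A_mult q (A_mult q s t) a = A_mult q s (A_mult q t a)"
  by (subst E_inject[symmetric]) (simp only: E_mult mult.assoc)

lemma A_mult_commute: "A_mult q s t = A_mult q t s"
  by (subst E_inject[symmetric]) (simp only: E_mult mult.commute)

lemma A_mult_scal: "A_mult q t (scal r) = (\<lambda>n. r * t n)"
  by (subst E_inject[symmetric]) (simp only: E_mult E_cmult E_scal mult.commute)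

lemma Phi_0: "Phi 0 = A_one" by (simp add: Phi_def A_one_def)

lemma A_mult_Phi_Psi: "A_mult q (Phi n) Psi = (\<lambda>k. Phi (Suc n) k + node q n * Phi n k)"
  by (subst E_inject[symmetric]) (simp only: E_mult E_add E_cmult E_Phi E_Psi ntheta_Suc fun_eq_iff, simp add: algebra_simps)

lemma Phi_Suc: "Phi (Suc n) = A_mult q (\<lambda>k. Psi k + scal (- node q n) k) (Phi n)"
  by (subst E_inject[symmetric]) (simp only: E_mult E_add E_scal E_Phi E_Psi ntheta_Suc fun_eq_iff, simp add: algebra_simps)

text \<open>The action through the values, for which \<gamma> is linear by construction. The action
  that belongs to UM is \<open>right_mult\<close>, through the argument.\<close>

definition left_mult :: "(nat \<Rightarrow> rat) \<Rightarrow> ((nat \<Rightarrow> rat) \<Rightarrow> 'm) \<Rightarrow> (nat \<Rightarrow> rat) \<Rightarrow> 'm" where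
  "left_mult a f = (\<lambda>t\<in>A_set p. act (E a) (f t))"

definition right_mult :: "(nat \<Rightarrow> rat) \<Rightarrow> ((nat \<Rightarrow> rat) \<Rightarrow> 'm) \<Rightarrow> (nat \<Rightarrow> rat) \<Rightarrow> 'm" where
  "right_mult a f = (\<lambda>t\<in>A_set p. f (A_mult q t a))"

definition U_sum :: "((nat \<Rightarrow> rat) \<Rightarrow> 'm) \<Rightarrow> ((nat \<Rightarrow> rat) \<Rightarrow> 'm) \<Rightarrow> (nat \<Rightarrow> rat) \<Rightarrow> 'm" where
  "U_sum f g = (\<lambda>t\<in>A_set p. f t \<oplus>\<^bsub>M\<^esub> g t)"

definition beta :: "((nat \<Rightarrow> rat) \<Rightarrow> 'm) \<Rightarrow> (nat \<Rightarrow> rat) \<Rightarrow> 'm" where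
  "beta f = (\<lambda>t\<in>A_set p. act (node q) (f t) \<ominus>\<^bsub>M\<^esub> f (A_mult q t Psi))"

lemma left_mult_apply [simp]: "t \<in> A_set p \<Longrightarrow> left_mult a f t = act (E a) (f t)" by (simp add: left_mult_def)
lemma right_mult_apply [simp]: "t \<in> A_set p \<Longrightarrow> right_mult a f t = f (A_mult q t a)" by (simp add: right_mult_def)
lemma U_sum_apply [simp]: "t \<in> A_set p \<Longrightarrow> U_sum f g t = f t \<oplus>\<^bsub>M\<^esub> g t" by (simp add: U_sum_def)
lemma beta_apply [simp]:
  "t \<in> A_set p \<Longrightarrow> beta f t = act (node q) (f t) \<ominus>\<^bsub>M\<^esub> f (A_mult q t Psi)" by (simp add: beta_def)

lemma good_left_mult: assumes "good m f" "a \<in> A_set p" shows "good m (left_mult a f)"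
proof -
  note f = goodD[OF assms(1)]
  have "left_mult a f \<in> U" unfolding left_mult_def
    by (rule U_restrictI[of _ m])
      (use f(1) assms in \<open>simp_all add: U_add[OF f(1)] U_scal[OF f(1)] f(2) act_add_right act_commute\<close>)
  thus ?thesis using f assms A_filt_subset unfolding good_def by simp
qed

lemma good_right_mult: assumes "good m f" "a \<in> A_set p" shows "good m (right_mult a f)"
proof -
  note f = goodD[OF assms(1)]
  have "right_mult a f \<in> U" unfolding right_mult_def
    by (rule U_restrictI[of _ m])
      (use f(1) assms in \<open>simp_all add: A_mult_add_left A_mult_cmult_left U_add[OF f(1)] U_scal[OF f(1)] f(2) A_filt_mult\<close>)
  thus ?thesis using f assms A_filt_subset unfolding good_def by (simp add: A_filt_mult)
qed

lemma good_U_sum: assumes "good m f" "good m g" shows "good m (U_sum f g)"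
proof -
  note f = goodD[OF assms(1)] and g = goodD[OF assms(2)]
  have "U_sum f g \<in> U" unfolding U_sum_def
    by (rule U_restrictI[of _ m])
      (use f(1) g(1) assms in \<open>simp_all add: U_add[OF f(1)] U_scal[OF f(1)] U_add[OF g(1)] U_scal[OF g(1)]
        f(2) g(2) act_add_right M.a_ac\<close>)
  thus ?thesis using f g A_filt_subset unfolding good_def by simp
qed

lemma good_beta: assumes "good m f" shows "good m (beta f)"
proof -
  note f = goodD[OF assms(1)]
  have "beta f \<in> U" unfolding beta_def
    by (rule U_restrictI[of _ m])
      (use f(1) assms in \<open>simp_all add: A_mult_add_left A_mult_cmult_left U_add[OF f(1)] U_scal[OF f(1)]
        f(2) A_filt_mult act_add_right act_minus_right minus_add_distrib act_commute minus_eq_zero_iff\<close>)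
  thus ?thesis using f A_filt_subset unfolding good_def by (simp add: A_filt_mult minus_eq_zero_iff)
qed

lemma U_left_mult [simp]: "f \<in> U \<Longrightarrow> a \<in> A_set p \<Longrightarrow> left_mult a f \<in> U"
  and U_right_mult [simp]: "f \<in> U \<Longrightarrow> a \<in> A_set p \<Longrightarrow> right_mult a f \<in> U"
  and U_beta [simp]: "f \<in> U \<Longrightarrow> beta f \<in> U"
  using good_exists good_left_mult good_right_mult good_beta goodD(1) by metis+

text \<open>Since \<Phi>_n \<Psi>^q = \<Phi>_(n+1) + q_(n+1) \<Phi>_n, and \<open>node q n\<close>
  is q_(n+1).\<close>

lemma beta_Phi:
  assumes "f \<in> U"
  shows "beta f (Phi n) = act (\<lambda>i. node q i - node q n) (f (Phi n)) \<ominus>\<^bsub>M\<^esub> f (Phi (Suc n))"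
proof -
  let ?x = "f (Phi n)" and ?y = "f (Phi (Suc n))" and ?z = "act (\<lambda>_. node q n) (f (Phi n))"
  have "f (A_mult q (Phi n) Psi) = ?y \<oplus>\<^bsub>M\<^esub> ?z"
    using assms U_add[of f "Phi (Suc n)" "\<lambda>k. node q n * Phi n k"] U_scal[of f "node q n" "Phi n"]
    by (simp add: A_mult_Phi_Psi)
  hence "beta f (Phi n) = act (node q) ?x \<ominus>\<^bsub>M\<^esub> (?y \<oplus>\<^bsub>M\<^esub> ?z)" by simp
  also have "\<dots> = (act (node q) ?x \<ominus>\<^bsub>M\<^esub> ?z) \<ominus>\<^bsub>M\<^esub> ?y"
    using assms by (simp add: M.minus_eq M.minus_add M.a_ac)
  also have "act (node q) ?x \<ominus>\<^bsub>M\<^esub> ?z = act (\<lambda>i. node q i - node q n) ?x"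
    using assms by (simp add: act_diff_left)
  finally show ?thesis .
qed

section \<open>The map $\gamma$\<close>

definition divdiff :: "nat \<Rightarrow> nat \<Rightarrow> rat" where
  "divdiff n i = (if i < n then 1 / (\<Prod>j\<in>{..<n} - {i}. node q i - node q j) else 0)"

lemma divdiff_0 [simp]: "divdiff 0 i = 0" by (simp add: divdiff_def)

text \<open>The relation behind the telescoping. It holds at every node: at index n the factor on
  the left vanishes, and so does \<open>divdiff n n\<close> by the default value 0.\<close>

lemma divdiff_Suc: "divdiff (Suc n) i * (node q i - node q n) = divdiff n i"
proof (cases "i < n")
  case True
  hence "{..<Suc n} - {i} = insert n ({..<n} - {i})" by auto
  moreover have "node q i - node q n \<noteq> 0" using True inj_node[OF abs_q] by (auto simp: inj_eq)
  ultimately show ?thesis using True by (simp add: divdiff_def)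
qed (auto simp: divdiff_def less_Suc_eq)

lemma divdiff_nonzero: "i < n \<Longrightarrow> divdiff n i \<noteq> 0"
  using inj_node[OF abs_q] by (auto simp: divdiff_def inj_eq)

lemma divdiff_prod: "n \<le> n' \<Longrightarrow> divdiff n' i * (\<Prod>j\<in>{n..<n'}. node q i - node q j) = divdiff n i"
proof (induction n' rule: dec_induct)
  case (step k)
  thus ?case using divdiff_Suc[of k i] by (simp add: prod.atLeastLessThan_Suc) (metis mult.assoc mult.commute)
qed simp

text \<open>For n > m the function is only required to lie in \<open>eval_ring\<close>; then the
  terms of sums lie in M for every index, without side conditions.\<close>

lemma divdiff_interpolation:
  "\<exists>d::nat. d > 0 \<and> (\<exists>b. \<forall>n. b n \<in> eval_ring \<and> (n \<le> m \<longrightarrow> (\<forall>i<m. b n i = of_nat d * divdiff n i)))"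
proof -
  obtain d :: nat where d: "d > 0" "\<forall>n<Suc m. \<exists>b\<in>eval_ring. \<forall>i<m. b i = of_nat d * divdiff n i"
    using eval_ring_interpolation_family[of "Suc m" m divdiff] by blast
  have "\<exists>b. b \<in> eval_ring \<and> (n \<le> m \<longrightarrow> (\<forall>i<m. b i = of_nat d * divdiff n i))" for n
    using d(2) by (cases "n \<le> m") (auto simp: less_Suc_eq_le intro: exI[of _ "\<lambda>_. 0"])
  thus ?thesis using d(1) by metis
qed

definition denom :: "nat \<Rightarrow> nat" where
  "denom m = (SOME d. d > 0 \<and> (\<exists>b. \<forall>n. b n \<in> eval_ring \<and> (n \<le> m \<longrightarrow> (\<forall>i<m. b n i = of_nat d * divdiff n i))))"

definition interp :: "nat \<Rightarrow> nat \<Rightarrow> nat \<Rightarrow> rat" where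
  "interp m = (SOME b. \<forall>n. b n \<in> eval_ring \<and> (n \<le> m \<longrightarrow> (\<forall>i<m. b n i = of_nat (denom m) * divdiff n i)))"

lemma denom_pos [simp]: "denom m > 0"
  and interp_closed [simp]: "interp m n \<in> eval_ring"
  and interp_eq: "n \<le> m \<Longrightarrow> i < m \<Longrightarrow> interp m n i = of_nat (denom m) * divdiff n i"
proof -
  note d = someI_ex[OF divdiff_interpolation[of m], folded denom_def]
  note b = someI_ex[OF d[THEN conjunct2], folded interp_def]
  show "denom m > 0" "interp m n \<in> eval_ring" "n \<le> m \<Longrightarrow> i < m \<Longrightarrow> interp m n i = of_nat (denom m) * divdiff n i"
    using d b by blast+
qed

text \<open>\<open>interp m n\<close> interpolates \<open>divdiff n\<close> on the first \<open>m\<close> nodes with common denominator \<open>denom m\<close>, so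
  dividing the following sum by \<open>denom m\<close> gives $\sum_n C_{n+1} f_n$.\<close>
definition gsum :: "nat \<Rightarrow> ((nat \<Rightarrow> rat) \<Rightarrow> 'm) \<Rightarrow> 'm" where
  "gsum m f = finsum M (\<lambda>n. act (interp m (Suc n)) (f (Phi n))) {..<m}"

definition gamma :: "((nat \<Rightarrow> rat) \<Rightarrow> 'm) \<Rightarrow> ('m \<times> nat) set" where
  "gamma f = (let m = SOME m. good m f in MQ_class M (gsum m f) (denom m))"

lemma gsum_closed [simp]: "f \<in> U \<Longrightarrow> gsum m f \<in> carrier M"
  unfolding gsum_def by (rule finsum_closed') simp

lemma good_Phi: "good m f \<Longrightarrow> m \<le> n \<Longrightarrow> f (Phi n) = \<zero>\<^bsub>M\<^esub>"
  using goodD(2)[OF _ Phi_A_filt] .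

text \<open>Terms from m on vanish. On each earlier f_n, which lies in \<open>killed m\<close>, both
  sides act as the product of the two denominators and C_(n+1). The equation is cross-multiplied
  because the denominator depends on the level.\<close>

lemma gsum_cong:
  assumes "good m f" "m \<le> m'"
  shows "nact (denom m') (gsum m f) = nact (denom m) (gsum m' f)"
proof -
  have f: "f \<in> U" using goodD assms by blast
  have "finsum M (\<lambda>n. act (interp m' (Suc n)) (f (Phi n))) {..<m'} =
      finsum M (\<lambda>n. act (interp m' (Suc n)) (f (Phi n))) {..<m}"
    using assms f by (intro M.add.finprod_mono_neutral_cong_right) (auto simp: good_Phi)
  moreover have "nact (denom m') (act (interp m (Suc n)) (f (Phi n))) = nact (denom m) (act (interp m' (Suc n)) (f (Phi n)))"
    if "n < m" for n
    using assms that f goodD(3)[OF assms(1), of "Phi n"]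
    by (simp add: act_mult) (rule killed_cong[of _ m], auto simp: interp_eq)
  ultimately show ?thesis using f unfolding gsum_def
    by (simp add: act_finsum) (rule M.finsum_cong', auto)
qed

lemma gamma_eq: assumes "good m f" shows "gamma f = MQ_class M (gsum m f) (denom m)"
proof -
  define m' where "m' = (SOME m. good m f)"
  have m': "good m' f" unfolding m'_def by (rule someI) (rule assms)
  have f: "f \<in> U" using goodD assms by blast
  have "nact (denom m) (gsum m' f) = nact (denom m') (gsum m f)"
    using gsum_cong[OF assms, of m'] gsum_cong[OF m', of m] by (cases "m \<le> m'") auto
  hence "MQ_class M (gsum m' f) (denom m') = MQ_class M (gsum m f) (denom m)"
    using f by (intro MQ_class_eqI) auto
  thus ?thesis by (simp add: gamma_def m'_def Let_def)
qed

lemma gamma_closed [simp]: "f \<in> U \<Longrightarrow> gamma f \<in> carrier (MQ M)"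
  using good_exists[of f] by (auto simp: gamma_eq)

lemma gamma_U_sum:
  assumes "f \<in> U" "g \<in> U" shows "gamma (U_sum f g) = gamma f \<oplus>\<^bsub>MQ M\<^esub> gamma g"
proof -
  obtain m where m: "good m f" "good m g" using good_common assms by blast
  have "gsum m (U_sum f g) = gsum m f \<oplus>\<^bsub>M\<^esub> gsum m g" unfolding gsum_def
    using assms by (simp add: act_add_right)
  thus ?thesis using m assms
    by (simp add: gamma_eq[OF good_U_sum[OF m]] gamma_eq[OF m(1)] gamma_eq[OF m(2)] add_MQ) (rule MQ_class_eqI, auto simp: act_add_right act_mult)
qed

lemma gamma_left_mult:
  assumes "f \<in> U" "a \<in> A_set p" shows "gamma (left_mult a f) = a \<odot>\<^bsub>MQ M\<^esub> gamma f"
proof -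
  obtain m where m: "good m f" using good_exists assms by blast
  have "gsum m (left_mult a f) = act (E a) (gsum m f)" unfolding gsum_def
    using assms by (simp add: act_finsum act_commute[of _ "E a"])
  thus ?thesis using m assms by (simp add: gamma_eq[OF good_left_mult[OF m]] gamma_eq[OF m] smult_MQ)
qed

text \<open>Adding the boundary term C_k F_k makes the partial sum independent of k, and at k = 0 it
  vanishes because C_0 = 0, whatever F_0 is. F need not vanish eventually, so this applies both to
  the values of a homomorphism and to a recursive solution not yet known to be one.\<close>

lemma telescope:
  assumes "\<And>n. F n \<in> killed m" "\<And>n. g n \<in> killed m"
    and rec: "\<And>n. F (Suc n) = act (\<lambda>i. node q i - node q n) (F n) \<ominus>\<^bsub>M\<^esub> g n"
  shows "k \<le> m \<Longrightarrow> finsum M (\<lambda>n. act (interp m (Suc n)) (g n)) {..<k} \<oplus>\<^bsub>M\<^esub> act (interp m k) (F k) = \<zero>\<^bsub>M\<^esub>"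
proof (induction k)
  case 0
  have "act (interp m 0) (F 0) = act (\<lambda>_. 0) (F 0)"
    by (rule killed_cong[of _ m]) (auto simp: assms interp_eq)
  thus ?case using killed_closed[OF assms(1)] by simp
next
  case (Suc k)
  have c: "F n \<in> carrier M" "g n \<in> carrier M" for n using assms killed_closed by blast+
  let ?S = "finsum M (\<lambda>n. act (interp m (Suc n)) (g n)) {..<k}"
  have S: "?S \<in> carrier M" using c by (intro finsum_closed') auto
  have "act (interp m (Suc k)) (act (\<lambda>i. node q i - node q k) (F k)) = act (interp m k) (F k)"
    using Suc.prems c divdiff_Suc by (simp add: act_mult) (rule killed_cong[of _ m], auto simp: assms interp_eq mult.assoc)
  moreover have "act (\<lambda>i. node q i - node q k) (F k) = F (Suc k) \<oplus>\<^bsub>M\<^esub> g k"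
    using c by (simp add: rec minus_add_cancel)
  ultimately have *: "act (interp m k) (F k) = act (interp m (Suc k)) (F (Suc k)) \<oplus>\<^bsub>M\<^esub> act (interp m (Suc k)) (g k)"
    using c by (simp add: act_add_right)
  have "?S \<oplus>\<^bsub>M\<^esub> act (interp m k) (F k) = \<zero>\<^bsub>M\<^esub>" using Suc by simp
  thus ?case unfolding * using c S by (subst finsum_lessThan_Suc) (auto simp: M.a_ac)
qed

text \<open>At a good level f_m = 0, so the boundary term of \<open>telescope\<close>
  disappears.\<close>

lemma gamma_beta: assumes "f \<in> U" shows "gamma (beta f) = \<zero>\<^bsub>MQ M\<^esub>"
proof -
  obtain m where m: "good m f" using good_exists assms by blast
  have "f (Phi n) \<in> killed m" "beta f (Phi n) \<in> killed m" for n
    by (rule goodD(3)[OF m] goodD(3)[OF good_beta[OF m]], simp)+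
  moreover have "f (Phi (Suc n)) = act (\<lambda>i. node q i - node q n) (f (Phi n)) \<ominus>\<^bsub>M\<^esub> beta f (Phi n)" for n
    unfolding beta_Phi[OF assms] using assms
    by (simp add: M.minus_eq M.minus_add M.a_assoc[symmetric] M.r_neg)
  ultimately have "gsum m (beta f) \<oplus>\<^bsub>M\<^esub> act (interp m m) (f (Phi m)) = \<zero>\<^bsub>M\<^esub>"
    unfolding gsum_def by (intro telescope[of "\<lambda>n. f (Phi n)"]) auto
  hence "gsum m (beta f) = \<zero>\<^bsub>M\<^esub>" using assms by (simp add: good_Phi[OF m])
  thus ?thesis using m
    by (simp add: gamma_eq[OF good_beta[OF m]]) (subst MQ_class_eq_zero_iff, auto intro: exI[of _ 1])
qed

section \<open>Comparison of the two actions of A under \<gamma>\<close>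

lemma zero_add_MQ: "X \<in> carrier (MQ M) \<Longrightarrow> \<zero>\<^bsub>MQ M\<^esub> \<oplus>\<^bsub>MQ M\<^esub> X = X"
  by (auto simp: carrier_MQ zero_MQ add_MQ)

lemma restrict_cong: "(\<And>t. t \<in> A \<Longrightarrow> f t = g t) \<Longrightarrow> restrict f A = restrict g A"
  by (auto simp: restrict_def)

lemma left_mult_left_mult: "f \<in> U \<Longrightarrow> a \<in> A_set p \<Longrightarrow> b \<in> A_set p \<Longrightarrow> left_mult a (left_mult b f) = left_mult (A_mult q a b) f"
  by (simp add: left_mult_def[of a] left_mult_def[of "A_mult q a b"] act_mult E_mult cong: restrict_cong)

lemma right_mult_right_mult: "a \<in> A_set p \<Longrightarrow> b \<in> A_set p \<Longrightarrow> right_mult a (right_mult b f) = right_mult (A_mult q a b) f"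
  by (simp add: right_mult_def[of a] right_mult_def[of "A_mult q a b"] A_mult_assoc cong: restrict_cong)

lemma left_mult_add:
  "f \<in> U \<Longrightarrow> a \<in> A_set p \<Longrightarrow> b \<in> A_set p \<Longrightarrow> left_mult (\<lambda>n. a n + b n) f = U_sum (left_mult a f) (left_mult b f)"
  by (simp add: left_mult_def[of "\<lambda>n. a n + b n"] U_sum_def E_add act_add_left cong: restrict_cong)

lemma right_mult_add:
  "f \<in> U \<Longrightarrow> a \<in> A_set p \<Longrightarrow> b \<in> A_set p \<Longrightarrow> right_mult (\<lambda>n. a n + b n) f = U_sum (right_mult a f) (right_mult b f)"
  unfolding right_mult_def[of "\<lambda>n. a n + b n"] U_sum_def
  by (rule restrict_cong) (simp add: A_mult_add_right, rule U_add, auto)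

lemma right_mult_scal: "f \<in> U \<Longrightarrow> r \<in> Zploc p \<Longrightarrow> right_mult (scal r) f = left_mult (scal r) f"
  unfolding left_mult_def right_mult_def by (rule restrict_cong) (simp add: A_mult_scal U_scal E_scal)

text \<open>The two actions of $\Psi^q$ on \<open>U\<close> differ by \<open>beta\<close>, so \<open>gamma\<close> identifies them; this passes to
  polynomials in $\Psi^q$ and, by continuity, to all of $A$.\<close>
definition commuting :: "(nat \<Rightarrow> rat) set" where
  "commuting = {a \<in> A_set p. \<forall>f\<in>U. gamma (right_mult a f) = gamma (left_mult a f)}"

lemma commuting_scal: "r \<in> Zploc p \<Longrightarrow> scal r \<in> commuting"
  by (simp add: commuting_def right_mult_scal)

lemma commuting_add: "a \<in> commuting \<Longrightarrow> b \<in> commuting \<Longrightarrow> (\<lambda>n. a n + b n) \<in> commuting"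
  by (simp add: commuting_def left_mult_add right_mult_add gamma_U_sum)

text \<open>Membership of a is used for the homomorphism \<open>right_mult b f\<close>; linearity of
  \<open>gamma\<close> for \<open>left_mult\<close> then takes a outside, leaving membership of b
  for f itself.\<close>

lemma commuting_mult:
  assumes "a \<in> commuting" "b \<in> commuting" shows "A_mult q a b \<in> commuting"
proof -
  have ab: "a \<in> A_set p" "b \<in> A_set p" using assms by (auto simp: commuting_def)
  have "gamma (right_mult (A_mult q a b) f) = gamma (left_mult (A_mult q a b) f)" if f: "f \<in> U" for f
  proof -
    have "gamma (right_mult (A_mult q a b) f) = gamma (right_mult a (right_mult b f))" using ab by (simp add: right_mult_right_mult)
    also have "\<dots> = gamma (left_mult a (right_mult b f))" using assms(1) ab f by (simp add: commuting_def)
    also have "\<dots> = a \<odot>\<^bsub>MQ M\<^esub> gamma (right_mult b f)" using ab f by (simp add: gamma_left_mult)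
    also have "\<dots> = a \<odot>\<^bsub>MQ M\<^esub> gamma (left_mult b f)" using assms(2) f by (simp add: commuting_def)
    also have "\<dots> = gamma (left_mult (A_mult q a b) f)" using ab f by (simp add: left_mult_left_mult flip: gamma_left_mult)
    finally show ?thesis .
  qed
  thus ?thesis using ab by (simp add: commuting_def)
qed

lemma commuting_Psi: "Psi \<in> commuting"
proof -
  have "gamma (right_mult Psi f) = gamma (left_mult Psi f)" if f: "f \<in> U" for f
  proof -
    have "left_mult Psi f = U_sum (beta f) (right_mult Psi f)"
      unfolding left_mult_def U_sum_def
      by (rule restrict_cong) (use f in \<open>simp add: E_Psi minus_add_cancel\<close>)
    thus ?thesis using f by (simp add: gamma_U_sum gamma_beta zero_add_MQ)
  qed
  thus ?thesis by (simp add: commuting_def)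
qed

lemma commuting_Phi: "Phi n \<in> commuting"
proof (induction n)
  case 0
  show ?case by (simp add: Phi_0 A_one_scal commuting_scal)
next
  case (Suc n)
  thus ?case unfolding Phi_Suc by (intro commuting_mult commuting_add commuting_Psi commuting_scal) simp_all
qed

lemma commuting_trunc: "a \<in> A_set p \<Longrightarrow> trunc K a \<in> commuting"
proof (induction K)
  case 0
  have "(\<lambda>_. 0) = scal 0" by (simp add: scal_def)
  thus ?case by (simp add: trunc_0 commuting_scal)
next
  case (Suc K)
  have "trunc (Suc K) a = (\<lambda>n. trunc K a n + A_mult q (Phi K) (scal (a K)) n)"
    by (simp add: trunc_Suc A_mult_scal)
  thus ?case using Suc by (simp add: commuting_add commuting_mult commuting_Phi commuting_scal)
qed

text \<open>At a good level both actions depend only on a truncation of a: the one through the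
  argument because f kills the ideal A_m, the one through the values because A_m kills them.\<close>

lemma gamma_right_mult:
  assumes "f \<in> U" "a \<in> A_set p" shows "gamma (right_mult a f) = gamma (left_mult a f)"
proof -
  obtain m where m: "good m f" using good_exists assms by blast
  have "right_mult a f = right_mult (trunc m a) f" unfolding right_mult_def
  proof (rule restrict_cong)
    fix t assume t: "t \<in> A_set p"
    let ?r = "\<lambda>n. a n - trunc m a n"
    have r: "?r \<in> A_filt p m" using assms by (simp add: trunc_tail)
    have "f (A_mult q t ?r) = \<zero>\<^bsub>M\<^esub>"
      using goodD(2)[OF m A_filt_mult[OF r t]] by (simp add: A_mult_commute)
    moreover have "A_mult q t a = (\<lambda>n. A_mult q t (trunc m a) n + A_mult q t ?r n)"
      using A_mult_add_right[of t "trunc m a" ?r] by simp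
    ultimately show "f (A_mult q t a) = f (A_mult q t (trunc m a))"
      using U_add[OF assms(1), of "A_mult q t (trunc m a)" "A_mult q t ?r"] t assms by simp
  qed
  moreover have "left_mult a f = left_mult (trunc m a) f" unfolding left_mult_def
    by (rule restrict_cong, rule killed_cong[OF goodD(3)[OF m]])
      (use assms in \<open>auto intro!: eval_seq_cong simp: trunc_def\<close>)
  ultimately show ?thesis using commuting_trunc[of a m] assms by (simp add: commuting_def)
qed

section \<open>Exactness\<close>

definition alpha :: "'m \<Rightarrow> (nat \<Rightarrow> rat) \<Rightarrow> 'm" where
  "alpha x = (\<lambda>t\<in>A_set p. act (E t) x)"

lemma alpha_U: assumes "x \<in> carrier M" shows "alpha x \<in> U"
proof -
  obtain m where "x \<in> killed m" using killed_exists assms by blast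
  thus ?thesis unfolding alpha_def
    by (intro U_restrictI[of _ m])
      (use assms in \<open>auto simp: E_add E_cmult act_add_left act_mult killed_iff A_filt_iff\<close>)
qed

lemma alpha_apply [simp]: "t \<in> A_set p \<Longrightarrow> alpha x t = act (E t) x"
  by (simp add: alpha_def)

lemma inj_alpha: "inj_on alpha (carrier M)"
proof (rule inj_onI)
  fix x y assume xy: "x \<in> carrier M" "y \<in> carrier M" "alpha x = alpha y"
  hence "alpha x A_one = alpha y A_one" by simp
  hence "act (E A_one) x = act (E A_one) y" by (simp only: alpha_apply A_set_intros)
  thus "x = y" using xy(1,2) by (simp add: A_one_scal E_scal)
qed

lemma zero_UM_iff: "f \<in> U \<Longrightarrow> f = \<zero>\<^bsub>UM p q M\<^esub> \<longleftrightarrow> (\<forall>t\<in>A_set p. f t = \<zero>\<^bsub>M\<^esub>)"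
  unfolding UM_sel
  by (auto intro!: extensionalityI[of f "A_set p"] restrict_extensional intro: U_extensional)

lemma beta_alpha: "x \<in> carrier M \<Longrightarrow> beta (alpha x) = \<zero>\<^bsub>UM p q M\<^esub>"
  by (simp add: zero_UM_iff alpha_U act_mult E_mult E_Psi minus_eq_zero_iff mult.commute)

text \<open>Here f_(n+1) = (\<Psi>^q - q_(n+1)) f_n, so f_n = \<Phi>_n f_0, and f_0 is the value at
  \<open>A_one\<close>.\<close>

lemma ker_beta:
  assumes "f \<in> U" "beta f = \<zero>\<^bsub>UM p q M\<^esub>"
  shows "f = alpha (f A_one)"
proof (rule U_eqI)
  show "f (Phi n) = alpha (f A_one) (Phi n)" for n
  proof (induction n)
    case 0
    show ?case using assms by (simp add: E_Phi Phi_0 A_one_scal E_scal)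
  next
    case (Suc n)
    have "beta f (Phi n) = \<zero>\<^bsub>M\<^esub>"
      using zero_UM_iff[OF U_beta[OF assms(1)], THEN iffD1, OF assms(2)] by (rule bspec) simp
    hence "act (\<lambda>i. node q i - node q n) (f (Phi n)) = f (Phi (Suc n))"
      using assms(1) by (simp add: beta_Phi minus_eq_zero_iff del: beta_apply)
    thus ?case using Suc assms(1)
      by (simp add: act_mult E_Phi ntheta_Suc[abs_def] mult.commute)
  qed
qed (use assms alpha_U in auto)

lemma ker_gamma:
  assumes "g \<in> U" "gamma g = \<zero>\<^bsub>MQ M\<^esub>"
  shows "\<exists>f\<in>U. beta f = g"
proof -
  obtain m where m: "good m g" using good_exists assms by blast
  \<comment> \<open>This solves \<beta>(f) = g on the \<open>Phi n\<close>. The initial value is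
    free, since adding some \<alpha>(x) changes f_0 by x and leaves \<beta>(f) unchanged.\<close>
  define F where "F = rec_nat \<zero>\<^bsub>M\<^esub> (\<lambda>n x. act (\<lambda>i. node q i - node q n) x \<ominus>\<^bsub>M\<^esub> g (Phi n))"
  have F_0: "F 0 = \<zero>\<^bsub>M\<^esub>" and F_Suc: "F (Suc n) = act (\<lambda>i. node q i - node q n) (F n) \<ominus>\<^bsub>M\<^esub> g (Phi n)" for n
    by (simp_all add: F_def)
  have gK: "g (Phi n) \<in> killed m" for n using goodD(3)[OF m] by simp
  have FK: "F n \<in> killed m" for n by (induction n) (simp_all add: F_0 F_Suc gK)
  have FM: "F n \<in> carrier M" for n using FK killed_closed by blast
  let ?y = "act (interp m m) (F m)"
  have y: "gsum m g \<oplus>\<^bsub>M\<^esub> ?y = \<zero>\<^bsub>M\<^esub>"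
    unfolding gsum_def by (rule telescope[OF FK gK F_Suc]) simp
  obtain u where u: "u > 0" "nact u (gsum m g) = \<zero>\<^bsub>M\<^esub>"
    using assms by (auto simp: gamma_eq[OF m] MQ_class_eq_zero_iff)
  have uy: "nact u ?y = \<zero>\<^bsub>M\<^esub>"
    using arg_cong[OF y, of "nact u"] u(2) assms(1) FM by (simp add: act_add_right)
  \<comment> \<open>C_m has no zero among the first m nodes, so its inverse can be interpolated
    there; this recovers a multiple of F_m from the torsion element C_m F_m.\<close>
  obtain d b where d: "(d::nat) > 0" "b \<in> eval_ring" "\<And>i. i < m \<Longrightarrow> b i = of_nat d * (1 / divdiff m i)"
    using eval_ring_interpolation[of m "\<lambda>i. 1 / divdiff m i"] by blast
  have "nact (d * denom m * u) (F m) = act b (nact u ?y)"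
    unfolding act_mult[OF eval_ring_const interp_closed FM, OF Zploc_simps(2)]
    using FM d(2) by (simp add: act_mult) (rule killed_cong[OF FK], auto simp: d interp_eq divdiff_nonzero)
  hence "nact (d * denom m * u) (F m) = \<zero>\<^bsub>M\<^esub>" using uy d(2) by simp
  moreover obtain k w where w: "d * denom m * u = p ^ k * w" "inverse (of_nat w) \<in> Zploc p" "w > 0"
    using prime_power_split[OF prime_p, of "d * denom m * u"] d u by auto
  ultimately have "nact (p ^ k * w) (F m) = \<zero>\<^bsub>M\<^esub>" by simp
  moreover have "act (\<lambda>_. inverse (of_nat w)) (nact (p ^ k * w) (F m)) = nact (p ^ k) (F m)"
  proof -
    have "inverse (of_nat w) * of_nat (p ^ k * w) = (of_nat (p ^ k) :: rat)" using w(3) by simp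
    thus ?thesis using w FM by (simp only: act_mult eval_ring_const Zploc_simps)
  qed
  ultimately have torsion: "nact (p ^ k) (F m) = \<zero>\<^bsub>M\<^esub>" using w by simp
  \<comment> \<open>From index m on all g_n vanish, so the recursion only multiplies by further
    factors.\<close>
  have F_prod: "F n = act (\<lambda>i. \<Prod>j\<in>{m..<n}. node q i - node q j) (F m)" if "n \<ge> m" for n
    using that
  proof (induction n rule: dec_induct)
    case base
    show ?case using FM by simp
  next
    case (step n)
    have "F (Suc n) = act (\<lambda>i. node q i - node q n) (F n)"
      using step FM by (simp add: F_Suc good_Phi[OF m] M.minus_eq)
    thus ?case using step FM by (simp add: act_mult prod.atLeastLessThan_Suc mult.commute)
  qed
  obtain n' b c where n': "n' \<ge> m" "b \<in> eval_ring" "c \<in> eval_ring"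
    "\<And>i. (\<Prod>j\<in>{m..<n'}. node q i - node q j) = b i * ntheta q m i + of_nat p ^ k * c i"
    using node_product_mod_power[of m m k] by blast
  \<comment> \<open>The multiple of \<Theta>_m kills F_m by its level, and the remaining multiple of
    p^k kills it by torsion.\<close>
  have "F n' = act (\<lambda>i. c i * of_nat (p ^ k)) (F m)"
    unfolding F_prod[OF n'(1)] by (rule killed_cong[OF FK]) (use n' in auto)
  also have "\<dots> = act c (nact (p ^ k) (F m))"
    using n' FM by (simp add: act_mult)
  finally have Fn': "F n' = \<zero>\<^bsub>M\<^esub>" using torsion n' by simp
  have "F n = \<zero>\<^bsub>M\<^esub>" if "n \<ge> n'" for n
    using that by (induction n rule: dec_induct) (use n'(1) in \<open>simp_all add: Fn' F_Suc good_Phi[OF m] M.minus_eq\<close>)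
  then obtain f where f: "f \<in> U" "\<And>n. f (Phi n) = F n" using U_of_sequence[of F n'] FM by blast
  have "beta f = g"
  proof (rule U_eqI)
    fix n
    have "g (Phi n) \<in> carrier M" using assms by simp
    thus "beta f (Phi n) = g (Phi n)"
      using f FM by (simp add: beta_Phi F_Suc M.minus_eq M.minus_add M.a_assoc[symmetric] M.r_neg del: beta_apply)
  qed (use f assms in auto)
  thus ?thesis using f by blast
qed

text \<open>A homomorphism supported at one \<Phi>_r suffices: \<gamma>(f) = C_(r+1) f_r, so f_r
  must be x divided by s C_(r+1). For suitable r this division is possible inside A, because up to a
  power of p the inverse of C_(r+1) lies in A on the first m nodes.\<close>

lemma gamma_surj:
  assumes "X \<in> carrier (MQ M)" shows "\<exists>f\<in>U. gamma f = X"
proof -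
  obtain x s where x: "x \<in> carrier M" "s > 0" "X = MQ_class M x s" using assms carrier_MQ by blast
  \<comment> \<open>Positivity of m makes n' positive, so that r = n' - 1 exists.\<close>
  obtain m where m: "x \<in> killed m" "m > 0"
    using killed_exists[OF x(1)] killed_mono[of x _ "Suc _"] by (metis le_SucI order.refl zero_less_Suc)
  obtain d b where d: "(d::nat) > 0" "b \<in> eval_ring" "\<And>i. i < m \<Longrightarrow> b i = of_nat d * (1 / divdiff m i)"
    using eval_ring_interpolation[of m "\<lambda>i. 1 / divdiff m i"] by blast
  obtain k w where w: "d * s = p ^ k * w" "inverse (of_nat w) \<in> Zploc p" "w > 0"
    using prime_power_split[OF prime_p, of "d * s"] d x by auto
  \<comment> \<open>On the first m nodes C_m = C_n' p^k c and 1/C_m = b/d, so 1/(s C_n') = p^k c b /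
    (d s) = c b / w. The exponent k was chosen to cancel exactly the p-part of d s.\<close>
  obtain n' b' c where n': "n' \<ge> m" "c \<in> eval_ring"
    "\<And>i. (\<Prod>j\<in>{m..<n'}. node q i - node q j) = b' i * ntheta q m i + of_nat p ^ k * c i"
    using node_product_mod_power[of m m k] by blast
  obtain r where r: "n' = Suc r" using n' m by (cases n') auto
  define v where "v i = inverse (of_nat w) * (b i * c i)" for i
  have v: "v \<in> eval_ring" unfolding v_def using w d n' by simp
  have key: "of_nat s * (divdiff n' i * v i) = 1" if "i < m" for i
  proof -
    have "divdiff n' i * (of_nat p ^ k * c i) = divdiff m i"
      using divdiff_prod[OF n'(1), of i] n'(3)[of i] that by simp
    hence "divdiff n' i * c i * b i * of_nat (p ^ k) = of_nat d"
      using divdiff_nonzero[OF that] d(3)[OF that] by (simp add: field_simps)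
    hence "(of_nat s * (divdiff n' i * v i)) * of_nat (p ^ k * w) = of_nat (d * s)"
      using w(3) by (simp add: v_def field_simps)
    thus ?thesis using w d x prime_gt_0_nat[OF prime_p] by (simp del: of_nat_mult)
  qed
  have "\<exists>f\<in>U. \<forall>n. f (Phi n) = (if r = n then act v x else \<zero>\<^bsub>M\<^esub>)"
    by (rule U_of_sequence[of _ "Suc r"]) (use v x in auto)
  then obtain f where f: "f \<in> U" "\<And>n. f (Phi n) = (if r = n then act v x else \<zero>\<^bsub>M\<^esub>)" by blast
  \<comment> \<open>The level must exceed r, so that the only nonzero term occurs in the sum. The
    identities below still need only the first m nodes, since x lies in
    \<open>killed m\<close>.\<close>
  obtain N where N: "good N f" "n' \<le> N"
    using good_exists[OF f(1)] good_mono max.cobounded1 max.cobounded2 by metis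
  have "gsum N f = finsum M (\<lambda>n. if r = n then act (interp N (Suc n)) (act v x) else \<zero>\<^bsub>M\<^esub>) {..<N}"
    unfolding gsum_def using v x by (intro M.finsum_cong') (auto simp: f)
  also have "\<dots> = act (interp N n') (act v x)"
    using N r v x by (subst M.finsum_singleton) auto
  finally have gs: "gsum N f = act (interp N n') (act v x)" .
  have "nact s (gsum N f) = nact (denom N) x"
    unfolding gs using v x
  proof (simp add: act_mult, intro killed_cong[OF m(1)])
    fix i assume i: "i < m"
    hence "interp N n' i = of_nat (denom N) * divdiff n' i" using interp_eq N n' by simp
    thus "of_nat s * (interp N n' i * v i) = of_nat (denom N)" using key[OF i] by (simp add: algebra_simps)
  qed auto
  hence "gamma f = X" unfolding gamma_eq[OF N(1)] x(3) using f x by (intro MQ_class_eqI) auto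
  thus ?thesis using f by blast
qed

section \<open>Linearity of the three maps over A\<close>

lemma hom_alpha: "Amod_hom (A_ring p q) M (UM p q M) alpha"
proof -
  have "alpha (x \<oplus>\<^bsub>M\<^esub> y) = U_sum (alpha x) (alpha y)" if "x \<in> carrier M" "y \<in> carrier M" for x y
    unfolding alpha_def[of "x \<oplus>\<^bsub>M\<^esub> y"] U_sum_def
    by (rule restrict_cong) (use that in \<open>simp add: act_add_right\<close>)
  moreover have "alpha (a \<odot>\<^bsub>M\<^esub> x) = right_mult a (alpha x)" if "a \<in> A_set p" "x \<in> carrier M" for a x
    unfolding alpha_def[of "a \<odot>\<^bsub>M\<^esub> x"] right_mult_def
    by (rule restrict_cong) (use that in \<open>simp add: E_mult act_mult flip: act_E\<close>)
  ultimately show ?thesis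
    unfolding Amod_hom_def UM_sel A_ring_simps by (auto simp: alpha_U simp flip: U_sum_def right_mult_def)
qed

text \<open>Multiplying the argument by a commutes with \<Psi>^q on the values trivially, and with
  \<Psi>^q on the argument because A is commutative.\<close>

lemma hom_beta: "Amod_hom (A_ring p q) (UM p q M) (UM p q M) beta"
proof -
  have "beta (U_sum f g) = U_sum (beta f) (beta g)" if "f \<in> U" "g \<in> U" for f g
    unfolding beta_def[of "U_sum f g"] U_sum_def[of "beta f"]
    by (rule restrict_cong) (use that in \<open>simp add: act_add_right minus_add_distrib\<close>)
  moreover have "beta (right_mult a f) = right_mult a (beta f)" if "f \<in> U" "a \<in> A_set p" for a f
    unfolding beta_def[of "right_mult a f"] right_mult_def[of a "beta f"]
    by (rule restrict_cong) (use that in \<open>simp add: A_mult_assoc A_mult_commute[of Psi]\<close>)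
  ultimately show ?thesis
    unfolding Amod_hom_def UM_sel A_ring_simps by (auto simp flip: U_sum_def right_mult_def)
qed

lemma hom_gamma: "Amod_hom (A_ring p q) (UM p q M) (MQ M) gamma"
  unfolding Amod_hom_def UM_sel A_ring_simps
  by (auto simp: gamma_U_sum gamma_right_mult gamma_left_mult simp flip: U_sum_def right_mult_def)

lemma exact_sequence:
  "inj_on alpha (carrier M)"
  "alpha ` carrier M = {f \<in> carrier (UM p q M). beta f = \<zero>\<^bsub>UM p q M\<^esub>}"
  "beta ` carrier (UM p q M) = {f \<in> carrier (UM p q M). gamma f = \<zero>\<^bsub>MQ M\<^esub>}"
  "gamma ` carrier (UM p q M) = carrier (MQ M)"
proof -
  show "inj_on alpha (carrier M)" by (rule inj_alpha)
  have "f \<in> alpha ` carrier M" if "f \<in> U" "beta f = \<zero>\<^bsub>UM p q M\<^esub>" for f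
    using ker_beta[OF that] that by (intro image_eqI[of _ _ "f A_one"]) simp_all
  thus "alpha ` carrier M = {f \<in> carrier (UM p q M). beta f = \<zero>\<^bsub>UM p q M\<^esub>}"
    using alpha_U beta_alpha by (auto simp: UM_sel(1))
  show "beta ` carrier (UM p q M) = {f \<in> carrier (UM p q M). gamma f = \<zero>\<^bsub>MQ M\<^esub>}"
    using ker_gamma gamma_beta by (auto simp: UM_sel(1))
  show "gamma ` carrier (UM p q M) = carrier (MQ M)"
    using gamma_surj by (auto simp: UM_sel(1))
qed

end

theorem theorem5p7:
  fixes p :: nat and q :: int and M :: "((nat \<Rightarrow> rat), 'm) module"
  assumes "prime p" and "odd p"
    and "prim_root_mod (int p ^ 2) q"
    and "Module.module (A_ring p q) M"
    and "A_discrete p M"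
  shows "\<exists>\<alpha> \<beta> \<gamma>.
     Amod_hom (A_ring p q) M (UM p q M) \<alpha> \<and>
     Amod_hom (A_ring p q) (UM p q M) (UM p q M) \<beta> \<and>
     Amod_hom (A_ring p q) (UM p q M) (MQ M) \<gamma> \<and>
     inj_on \<alpha> (carrier M) \<and>
     \<alpha> ` carrier M = {f \<in> carrier (UM p q M). \<beta> f = \<zero>\<^bsub>UM p q M\<^esub>} \<and>
     \<beta> ` carrier (UM p q M) = {f \<in> carrier (UM p q M). \<gamma> f = \<zero>\<^bsub>MQ M\<^esub>} \<and>
     \<gamma> ` carrier (UM p q M) = carrier (MQ M)"
proof -
  interpret discrete_module p q M
    using assms prim_root_nontrivial[OF assms(1-3)] by (simp add: discrete_module_def discrete_module_axioms_def)
  show ?thesis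
    using hom_alpha hom_beta hom_gamma exact_sequence by blast
qed

end
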